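(* Let $1\leqslant k\leqslant n-1$. Then $f:\Lambda^{k+1}\times\Lambda^{k-1}\rightarrow\mathbb{R}$ is ext-int. one affine if and only if there exist $g:\Lambda^{k+1}\rightarrow\mathbb{R}$ and $h:\Lambda^{k-1}\rightarrow\mathbb{R}$ such that $$f(\xi,\eta)=g(\xi)+h(\eta),\quad\text{for all }\xi\in\Lambda^{k+1},\ \eta\in\Lambda^{k-1},$$ where (i) $g$ is affine and $h$ is int. one affine, when $n\leqslant 2k-2$; (ii) $g$ and $h$ are affine, when $n=2k-1,2k,2k+1$, or both of $k,n$ are even; (iii) $g$ is ext. one affine and $h$ is affine, when $n\geqslant 2k+2$.
   Context: $\Lambda^k=\Lambda^k(\mathbb{R}^n)$ is the vector space of alternating $k$-linear maps on $\mathbb{R}^n$ (exterior $k$-forms), with $\Lambda^0=\mathbb{R}$ and $\Lambda^k=\{0\}$ for $k>n$; $\Lambda^1$ is identified with $\mathbb{R}^n$. $\wedge$ is the exterior product, $\langle\,;\rangle$ the Euclidean scalar product, and $\lrcorner$ the interior product: for $a\in\Lambda^1$, $b\in\Lambda^k$, the form $a\lrcorner b\in\Lambda^{k-1}$ satisfies $\langle a\lrcorner b;c\rangle=\langle b;a\wedge c\rangle$ for all $c\in\Lambda^{k-1}$. Definitions. (1) $f:\Lambda^{k+1}\times\Lambda^{k-1}\to\mathbb{R}$ is ext-int. one convex if for every $\xi\in\Lambda^{k+1}$, $\eta\in\Lambda^{k-1}$, $a\in\Lambda^1$, $b\in\Lambda^k$, the function $t\mapsto f(\xi+t\,a\wedge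 b,\ \eta+t\,a\lrcorner b)$ is convex on $\mathbb{R}$; it is ext-int. one affine if both $f$ and $-f$ are ext-int. one convex. (2) For $1\leqslant m\leqslant n$, $g:\Lambda^m\to\mathbb{R}$ is ext. one convex if for every $\omega\in\Lambda^m$, $a\in\Lambda^1$, $b\in\Lambda^{m-1}$, the function $t\mapsto g(\omega+t\,a\wedge b)$ is convex on $\mathbb{R}$; it is ext. one affine if both $g$ and $-g$ are ext. one convex. (3) For $0\leqslant m\leqslant n-1$, $h:\Lambda^m\to\mathbb{R}$ is int. one convex if for every $\omega\in\Lambda^m$, $a\in\Lambda^1$, $b\in\Lambda^{m+1}$, the function $t\mapsto h(\omega+t\,a\lrcorner b)$ is convex on $\mathbb{R}$; it is int. one affine if both $h$ and $-h$ are int. one convex. *)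

theory Defs
  imports "HOL-Analysis.Analysis"
begin

(* A k-form reads only the first k entries of the argument sequence.  The third clause of
   alt_forms enforces this, so that equality of k-forms is equality of HOL functions. *)
type_synonym 'n form = "(nat \<Rightarrow> real ^ 'n) \<Rightarrow> real"

definition alt_forms :: "nat \<Rightarrow> ('n::finite) form set" where
  "alt_forms k = {\<omega>.
     (\<forall>v. \<forall>i<k. linear (\<lambda>x. \<omega> (v(i := x)))) \<and>
     (\<forall>v. \<forall>i<k. \<forall>j<k. i \<noteq> j \<longrightarrow> v i = v j \<longrightarrow> \<omega> v = 0) \<and>
     (\<forall>v w. (\<forall>i<k. v i = w i) \<longrightarrow> \<omega> v = \<omega> w)}"

(* The usual sum over (k,l)-shuffles; summing over all permutations repeats each term
   k! l! times. *)
definition wedge :: "nat \<Rightarrow> nat \<Rightarrow> ('n::finite) form \<Rightarrow> 'n form \<Rightarrow> 'n form" where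
  "wedge k l \<alpha> \<beta> = (\<lambda>v.
     (\<Sum>p | p permutes {..<k + l}.
        of_int (sign p) * \<alpha> (\<lambda>i. v (p i)) * \<beta> (\<lambda>i. v (p (k + i)))) / (fact k * fact l))"

(* The Euclidean scalar product making the forms dx^I, I increasing, orthonormal: the sum over
   all index tuples counts each k-subset of the basis k! times. *)
definition form_inner :: "nat \<Rightarrow> ('n::finite) form \<Rightarrow> 'n form \<Rightarrow> real" where
  "form_inner k \<alpha> \<beta> =
     (\<Sum>J \<in> {..<k} \<rightarrow>\<^sub>E (UNIV :: 'n set).
        \<alpha> (\<lambda>i. axis (J i) 1) * \<beta> (\<lambda>i. axis (J i) 1)) / fact k"

(* For a 1-form a and a k-form b with k \<ge> 1; existence and uniqueness are shown in
   int_prod_unique below. *)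
definition int_prod :: "nat \<Rightarrow> ('n::finite) form \<Rightarrow> 'n form \<Rightarrow> 'n form" where
  "int_prod k a b = (THE d. d \<in> alt_forms (k - 1) \<and>
     (\<forall>c \<in> alt_forms (k - 1). form_inner (k - 1) d c = form_inner k b (wedge 1 (k - 1) a c)))"

definition ext_int_one_convex :: "nat \<Rightarrow> (('n::finite) form \<times> 'n form \<Rightarrow> real) \<Rightarrow> bool" where
  "ext_int_one_convex k f \<longleftrightarrow>
     (\<forall>\<xi> \<in> alt_forms (k + 1). \<forall>\<eta> \<in> alt_forms (k - 1). \<forall>a \<in> alt_forms 1. \<forall>b \<in> alt_forms k.
        convex_on UNIV (\<lambda>t::real.
          f (\<lambda>v. \<xi> v + t * wedge 1 k a b v, \<lambda>v. \<eta> v + t * int_prod k a b v)))"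

definition ext_int_one_affine :: "nat \<Rightarrow> (('n::finite) form \<times> 'n form \<Rightarrow> real) \<Rightarrow> bool" where
  "ext_int_one_affine k f \<longleftrightarrow> ext_int_one_convex k f \<and> ext_int_one_convex k (\<lambda>z. - f z)"

(* Meaningful for m \<ge> 1 only, as m - 1 is truncated subtraction. *)
definition ext_one_convex :: "nat \<Rightarrow> (('n::finite) form \<Rightarrow> real) \<Rightarrow> bool" where
  "ext_one_convex m g \<longleftrightarrow>
     (\<forall>\<omega> \<in> alt_forms m. \<forall>a \<in> alt_forms 1. \<forall>b \<in> alt_forms (m - 1).
        convex_on UNIV (\<lambda>t::real. g (\<lambda>v. \<omega> v + t * wedge 1 (m - 1) a b v)))"

definition ext_one_affine :: "nat \<Rightarrow> (('n::finite) form \<Rightarrow> real) \<Rightarrow> bool" where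
  "ext_one_affine m g \<longleftrightarrow> ext_one_convex m g \<and> ext_one_convex m (\<lambda>\<omega>. - g \<omega>)"

definition int_one_convex :: "nat \<Rightarrow> (('n::finite) form \<Rightarrow> real) \<Rightarrow> bool" where
  "int_one_convex m h \<longleftrightarrow>
     (\<forall>\<omega> \<in> alt_forms m. \<forall>a \<in> alt_forms 1. \<forall>b \<in> alt_forms (m + 1).
        convex_on UNIV (\<lambda>t::real. h (\<lambda>v. \<omega> v + t * int_prod (m + 1) a b v)))"

definition int_one_affine :: "nat \<Rightarrow> (('n::finite) form \<Rightarrow> real) \<Rightarrow> bool" where
  "int_one_affine m h \<longleftrightarrow> int_one_convex m h \<and> int_one_convex m (\<lambda>\<omega>. - h \<omega>)"

definition affine_on_forms :: "nat \<Rightarrow> (('n::finite) form \<Rightarrow> real) \<Rightarrow> bool" where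
  "affine_on_forms m g \<longleftrightarrow>
     (\<forall>\<omega> \<in> alt_forms m. \<forall>\<theta> \<in> alt_forms m. \<forall>t::real.
        g (\<lambda>v. (1 - t) * \<omega> v + t * \<theta> v) = (1 - t) * g \<omega> + t * g \<theta>)"

lemma alt_formsD:
  assumes "\<omega> \<in> alt_forms k"
  shows "i < k \<Longrightarrow> linear (\<lambda>x. \<omega> (v(i := x)))"
    and "i < k \<Longrightarrow> j < k \<Longrightarrow> i \<noteq> j \<Longrightarrow> v i = v j \<Longrightarrow> \<omega> v = 0"
    and "(\<And>i. i < k \<Longrightarrow> v i = w i) \<Longrightarrow> \<omega> v = \<omega> w"
  using assms unfolding alt_forms_def by blast+

lemma alt_forms_diff:
  fixes \<alpha> \<beta> :: "('n::finite) form"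
  assumes a: "\<alpha> \<in> alt_forms k" and b: "\<beta> \<in> alt_forms k"
  shows "(\<lambda>v. \<alpha> v - \<beta> v) \<in> alt_forms k"
  unfolding alt_forms_def
proof (intro CollectI conjI allI impI)
  fix v i assume i: "i < k"
  show "linear (\<lambda>x. \<alpha> (v(i := x)) - \<beta> (v(i := x)))"
    by (rule linear_compose_sub[OF alt_formsD(1)[OF a i] alt_formsD(1)[OF b i]])
next
  fix v :: "nat \<Rightarrow> real ^ 'n" and i j assume "i < k" "j < k" "i \<noteq> j" "v i = v j"
  then show "\<alpha> v - \<beta> v = 0" using alt_formsD(2)[OF a] alt_formsD(2)[OF b] by simp
next
  fix v w :: "nat \<Rightarrow> real ^ 'n" assume "\<forall>i<k. v i = w i"
  then show "\<alpha> v - \<beta> v = \<alpha> w - \<beta> w"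
    using alt_formsD(3)[OF a, of v w] alt_formsD(3)[OF b, of v w] by simp
qed

lemma alt_forms_transpose:
  assumes w: "\<omega> \<in> alt_forms k" and i: "i < k" and j: "j < k" and ij: "i \<noteq> j"
  shows "\<omega> (\<lambda>m. v (Transposition.transpose i j m)) = - \<omega> v"
proof -
  define u where "u x y = v(i := x, j := y)" for x y
  have add1: "\<omega> (u (x + x') y) = \<omega> (u x y) + \<omega> (u x' y)" for x x' y
    using linear_add[OF alt_formsD(1)[OF w i, of "v(j := y)"]] ij
    by (simp add: u_def fun_upd_twist)
  have add2: "\<omega> (u x (y + y')) = \<omega> (u x y) + \<omega> (u x y')" for x y y'
    using linear_add[OF alt_formsD(1)[OF w j, of "v(i := x)"]] by (simp add: u_def)
  have z: "\<omega> (u x x) = 0" for x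
    using alt_formsD(2)[OF w i j ij] ij by (simp add: u_def)
  have "\<omega> (u (v i + v j) (v i + v j)) = \<omega> (u (v i) (v j)) + \<omega> (u (v j) (v i))"
    by (simp only: add1 add2) (simp add: z)
  then have "\<omega> (u (v j) (v i)) = - \<omega> (u (v i) (v j))" unfolding z by linarith
  moreover have "u (v i) (v j) = v" by (auto simp: u_def)
  moreover have "u (v j) (v i) = (\<lambda>m. v (Transposition.transpose i j m))"
    using ij by (auto simp: u_def Transposition.transpose_def fun_eq_iff)
  ultimately show ?thesis by simp
qed

lemma alt_forms_permute:
  assumes w: "\<omega> \<in> alt_forms k" and p: "p permutes {..<k}"
  shows "\<omega> (\<lambda>m. v (p m)) = of_int (sign p) * \<omega> v"
proof -
  have "\<forall>v. \<omega> (\<lambda>m. v (p m)) = of_int (sign p) * \<omega> v"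
    using p finite_lessThan
  proof (induction rule: permutes_induct)
    case id
    then show ?case by (simp add: sign_id)
  next
    case (swap a b p)
    have perm: "permutation p" using swap.hyps finite_lessThan permutation_permutes by blast
    show ?case
    proof
      fix v
      have "\<omega> (\<lambda>m. v ((Transposition.transpose a b \<circ> p) m)) = \<omega> (\<lambda>m. (v \<circ> Transposition.transpose a b) (p m))"
        by (simp add: comp_def)
      also have "\<dots> = of_int (sign p) * \<omega> (v \<circ> Transposition.transpose a b)" using swap by blast
      also have "\<omega> (v \<circ> Transposition.transpose a b) = - \<omega> v"
        using alt_forms_transpose[OF w, of a b v] swap.hyps by (simp add: comp_def)
      finally show "\<omega> (\<lambda>m. v ((Transposition.transpose a b \<circ> p) m)) = of_int (sign (Transposition.transpose a b \<circ> p)) * \<omega> v"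
        using swap.hyps perm by (simp add: sign_compose permutation_swap_id sign_swap_id)
    qed
  qed
  then show ?thesis by blast
qed

lemma alt_forms_eq_0:
  fixes \<omega> :: "('n::finite) form"
  assumes w: "\<omega> \<in> alt_forms k"
    and z: "\<And>J :: nat \<Rightarrow> 'n. J \<in> {..<k} \<rightarrow>\<^sub>E UNIV \<Longrightarrow> \<omega> (\<lambda>i. axis (J i) 1) = 0"
  shows "\<omega> v = 0"
proof -
  have "\<forall>v. (\<forall>i. m \<le> i \<and> i < k \<longrightarrow> v i \<in> range (\<lambda>j. axis j 1)) \<longrightarrow> \<omega> v = 0" if "m \<le> k" for m
    using that
  proof (induction m)
    case 0
    show ?case
    proof (intro allI impI)
      fix v :: "nat \<Rightarrow> real ^ 'n"
      assume "\<forall>i. 0 \<le> i \<and> i < k \<longrightarrow> v i \<in> range (\<lambda>j. axis j 1)"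
      then have "\<forall>i. \<exists>j. i < k \<longrightarrow> v i = axis j 1" by blast
      then obtain J where J: "\<And>i. i < k \<Longrightarrow> v i = axis (J i) 1" by metis
      have "\<omega> v = \<omega> (\<lambda>i. axis (restrict J {..<k} i) 1)"
        by (rule alt_formsD(3)[OF w]) (simp add: J)
      also have "\<dots> = 0" by (rule z) (rule restrict_PiE_iff[THEN iffD2], simp)
      finally show "\<omega> v = 0" .
    qed
  next
    case (Suc m)
    then have m: "m < k" by simp
    show ?case
    proof (intro allI impI)
      fix v :: "nat \<Rightarrow> real ^ 'n"
      assume v: "\<forall>i. Suc m \<le> i \<and> i < k \<longrightarrow> v i \<in> range (\<lambda>j. axis j 1)"
      note lin = alt_formsD(1)[OF w m, of v]
      have *: "\<omega> (v(m := axis j 1)) = 0" for j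
        using Suc.IH m v by (auto simp: Suc_le_eq)
      have "\<omega> v = \<omega> (v(m := (\<Sum>j\<in>UNIV. v m $ j *\<^sub>R axis j 1)))"
        using basis_expansion[of "v m"] by (simp add: scalar_mult_eq_scaleR)
      also have "\<dots> = (\<Sum>j\<in>UNIV. v m $ j *\<^sub>R \<omega> (v(m := axis j 1)))"
        by (simp add: linear_sum[OF lin] linear_scale[OF lin])
      finally show "\<omega> v = 0" using * by simp
    qed
  qed
  from this[of k] show ?thesis by auto
qed

lemma wedge_in_alt_forms:
  fixes \<alpha> \<beta> :: "('n::finite) form"
  assumes a: "\<alpha> \<in> alt_forms k" and b: "\<beta> \<in> alt_forms l"
  shows "wedge k l \<alpha> \<beta> \<in> alt_forms (k + l)"
proof -
  define F where "F v p = of_int (sign p) * \<alpha> (\<lambda>i. v (p i)) * \<beta> (\<lambda>i. v (p (k + i)))" for v p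
  let ?P = "{p. p permutes {..<k + l}}"
  have W: "wedge k l \<alpha> \<beta> v = (1 / (fact k * fact l)) *\<^sub>R (\<Sum>p \<in> ?P. F v p)" for v
    by (simp add: wedge_def F_def)
  show ?thesis
    unfolding alt_forms_def
  proof (intro CollectI conjI allI impI)
    fix v :: "nat \<Rightarrow> real ^ 'n" and i assume i: "i < k + l"
    have "linear (\<lambda>x. F (v(i := x)) p)" if p: "p permutes {..<k + l}" for p
    proof -
      obtain j where j: "p j = i" using permutes_surj[OF p] by (metis surjD)
      have upd: "p m = i \<longleftrightarrow> m = j" for m
        using j inj_eq[OF permutes_inj[OF p], of m j] by simp
      have jl: "j < k + l" using permutes_in_image[OF p, of j] i j by simp
      show ?thesis
      proof (cases "j < k")
        case True
        have "F (v(i := x)) p = (of_int (sign p) * \<beta> (\<lambda>m. v (p (k + m)))) *\<^sub>R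
            \<alpha> ((\<lambda>m. v (p m))(j := x))" for x
        proof -
          have "(\<lambda>m. (v(i := x)) (p m)) = (\<lambda>m. v (p m))(j := x)"
            by (auto simp: upd fun_eq_iff)
          moreover have "(\<lambda>m. (v(i := x)) (p (k + m))) = (\<lambda>m. v (p (k + m)))"
            using True by (auto simp: upd fun_eq_iff)
          ultimately show ?thesis by (simp only: F_def) simp
        qed
        then show ?thesis
          by (simp only: linear_compose_scale_right[OF alt_formsD(1)[OF a True]])
      next
        case False
        then have jk: "j - k < l" using jl by simp
        have "F (v(i := x)) p = (of_int (sign p) * \<alpha> (\<lambda>m. v (p m))) *\<^sub>R
            \<beta> ((\<lambda>m. v (p (k + m)))(j - k := x))" for x
        proof -
          have "\<alpha> (\<lambda>m. (v(i := x)) (p m)) = \<alpha> (\<lambda>m. v (p m))"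
            using False by (intro alt_formsD(3)[OF a]) (simp add: upd)
          moreover have "(\<lambda>m. (v(i := x)) (p (k + m))) = (\<lambda>m. v (p (k + m)))(j - k := x)"
            using False by (auto simp: upd fun_eq_iff)
          ultimately show ?thesis by (simp only: F_def) simp
        qed
        then show ?thesis
          by (simp only: linear_compose_scale_right[OF alt_formsD(1)[OF b jk]])
      qed
    qed
    then have "linear (\<lambda>x. \<Sum>p \<in> ?P. F (v(i := x)) p)" by (intro linear_compose_sum) simp
    then show "linear (\<lambda>x. wedge k l \<alpha> \<beta> (v(i := x)))"
      unfolding W by (rule linear_compose_scale_right)
  next
    fix v :: "nat \<Rightarrow> real ^ 'n" and i j
    assume ij: "i < k + l" "j < k + l" "i \<noteq> j" "v i = v j"
    let ?t = "Transposition.transpose i j"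
    have t: "?t permutes {..<k + l}" using ij by (intro permutes_swap_id) auto
    have "(\<Sum>p \<in> ?P. F v p) = (\<Sum>p \<in> ?P. - F v p)"
    proof (rule sum.reindex_bij_witness[where i = "\<lambda>p. ?t \<circ> p" and j = "\<lambda>p. ?t \<circ> p"], goal_cases)
      case (5 p)
      have v: "v (?t m) = v m" for m using ij by (simp add: Transposition.transpose_def)
      have "permutation p" using 5 by (intro permutes_imp_permutation[OF finite_lessThan]) simp
      then show ?case
        using ij by (simp add: F_def v sign_compose permutation_swap_id sign_swap_id)
    qed (simp_all add: permutes_compose[OF _ t] fun_eq_iff)
    then have "(\<Sum>p \<in> ?P. F v p) = 0" by (simp add: sum_negf)
    then show "wedge k l \<alpha> \<beta> v = 0" by (simp add: W)
  next
    fix v w :: "nat \<Rightarrow> real ^ 'n" assume vw: "\<forall>i<k + l. v i = w i"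
    have "F v p = F w p" if p: "p permutes {..<k + l}" for p
    proof -
      have vp: "v (p i) = w (p i)" if "i < k + l" for i
        using vw permutes_in_image[OF p, of i] that by simp
      have "\<alpha> (\<lambda>i. v (p i)) = \<alpha> (\<lambda>i. w (p i))"
        by (rule alt_formsD(3)[OF a]) (simp add: vp)
      moreover have "\<beta> (\<lambda>i. v (p (k + i))) = \<beta> (\<lambda>i. w (p (k + i)))"
        by (rule alt_formsD(3)[OF b]) (simp add: vp)
      ultimately show ?thesis by (simp add: F_def)
    qed
    then have "(\<Sum>p \<in> ?P. F v p) = (\<Sum>p \<in> ?P. F w p)" by (intro sum.cong refl) simp
    then show "wedge k l \<alpha> \<beta> v = wedge k l \<alpha> \<beta> w" by (simp only: W)
  qed
qed

lemma form_inner_definite: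
  fixes \<omega> :: "('n::finite) form"
  assumes w: "\<omega> \<in> alt_forms k" and z: "form_inner k \<omega> \<omega> = 0"
  shows "\<omega> = (\<lambda>v. 0)"
proof
  fix v
  let ?S = "{..<k} \<rightarrow>\<^sub>E (UNIV :: 'n set)"
  have "(\<Sum>J \<in> ?S. \<omega> (\<lambda>i. axis (J i) 1) * \<omega> (\<lambda>i. axis (J i) 1)) = 0"
    using z by (simp add: form_inner_def)
  moreover have "finite ?S" by (rule finite_PiE) simp_all
  ultimately have *: "\<forall>J \<in> ?S. \<omega> (\<lambda>i. axis (J i) 1) * \<omega> (\<lambda>i. axis (J i) 1) = 0"
    using sum_nonneg_eq_0_iff[of ?S "\<lambda>J. \<omega> (\<lambda>i. axis (J i) 1) * \<omega> (\<lambda>i. axis (J i) 1)"]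
    by (simp only: zero_le_square simp_thms)
  have "\<omega> (\<lambda>i. axis (J i) 1) = 0" if "J \<in> ?S" for J
    using bspec[OF * that] by simp
  then show "\<omega> v = 0" by (rule alt_forms_eq_0[OF w])
qed

lemma contraction_in_alt_forms:
  fixes b :: "('n::finite) form"
  assumes b: "b \<in> alt_forms (Suc l)"
  shows "(\<lambda>v. b (case_nat x v)) \<in> alt_forms l"
  unfolding alt_forms_def
proof (intro CollectI conjI allI impI)
  fix v i assume i: "i < l"
  have "case_nat x (v(i := y)) = (case_nat x v)(Suc i := y)" for y
    by (auto simp: fun_eq_iff split: nat.split)
  then show "linear (\<lambda>y. b (case_nat x (v(i := y))))"
    using alt_formsD(1)[OF b, of "Suc i" "case_nat x v"] i by simp
next
  fix v :: "nat \<Rightarrow> real ^ 'n" and i j assume "i < l" "j < l" "i \<noteq> j" "v i = v j"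
  then show "b (case_nat x v) = 0"
    using alt_formsD(2)[OF b, of "Suc i" "Suc j" "case_nat x v"] by simp
next
  fix v w :: "nat \<Rightarrow> real ^ 'n" assume "\<forall>i<l. v i = w i"
  then show "b (case_nat x v) = b (case_nat x w)"
    by (intro alt_formsD(3)[OF b]) (auto split: nat.split)
qed

lemma contraction_adjoint:
  fixes a b c :: "('n::finite) form"
  assumes a: "a \<in> alt_forms 1" and b: "b \<in> alt_forms (Suc l)" and c: "c \<in> alt_forms l"
  defines "x \<equiv> (\<Sum>j\<in>UNIV. a (\<lambda>_. axis j 1) *\<^sub>R axis j 1)"
  shows "form_inner l (\<lambda>v. b (case_nat x v)) c = form_inner (Suc l) b (wedge 1 l a c)"
proof -
  let ?E = "\<lambda>J::nat \<Rightarrow> 'n. \<lambda>i. axis (J i) (1::real)"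
  let ?P = "{p. p permutes {..<Suc l}}"
  let ?S = "\<lambda>k. {..<k} \<rightarrow>\<^sub>E (UNIV :: 'n set)"
  define T where "T = (\<Sum>J \<in> ?S (Suc l). b (?E J) * (a (?E J) * c (\<lambda>i. ?E J (Suc i))))"
  have perm: "(\<Sum>J \<in> ?S (Suc l). b (?E J) * (of_int (sign p) * a (\<lambda>i. ?E J (p i)) *
      c (\<lambda>i. ?E J (p (Suc i))))) = T" if p: "p permutes {..<Suc l}" for p
  proof -
    note ip = permutes_inv[OF p]
    have "(\<Sum>J \<in> ?S (Suc l). b (?E J) * (of_int (sign p) * a (\<lambda>i. ?E J (p i)) *
        c (\<lambda>i. ?E J (p (Suc i))))) =
      (\<Sum>J \<in> ?S (Suc l). b (\<lambda>i. ?E J (inv p i)) * (of_int (sign p) * a (?E J) *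
        c (\<lambda>i. ?E J (Suc i))))"
      by (rule sum.reindex_bij_witness[where i = "\<lambda>J. J \<circ> inv p" and j = "\<lambda>J. J \<circ> p"])
        (auto simp: PiE_def extensional_def fun_eq_iff permutes_inverses[OF p]
          permutes_in_image[OF p, of _, simplified] permutes_in_image[OF ip, of _, simplified]
          permutes_not_in[OF p] permutes_not_in[OF ip])
    also have "\<dots> = T"
    proof -
      have "b (\<lambda>i. ?E J (inv p i)) = of_int (sign p) * b (?E J)" for J
        using alt_forms_permute[OF b ip, of "?E J"]
          sign_inverse[OF permutes_imp_permutation[OF finite_lessThan p]] by simp
      moreover have "of_int (sign p) * of_int (sign p) = (1::real)"
        by (simp flip: of_int_mult)
      ultimately show ?thesis unfolding T_def
        by (intro sum.cong refl) (simp add: algebra_simps)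
    qed
    finally show ?thesis .
  qed
  have "form_inner (Suc l) b (wedge 1 l a c) =
      (\<Sum>J \<in> ?S (Suc l). \<Sum>p \<in> ?P. b (?E J) * (of_int (sign p) * a (\<lambda>i. ?E J (p i)) *
        c (\<lambda>i. ?E J (p (Suc i))))) / fact l / fact (Suc l)"
    by (simp add: form_inner_def wedge_def sum_distrib_left sum_divide_distrib)
  also have "\<dots> = (\<Sum>p \<in> ?P. T) / fact l / fact (Suc l)"
    by (subst sum.swap) (simp add: perm)
  also have "\<dots> = T / fact l"
    using card_permutations[of "{..<Suc l}" "Suc l"] by (simp del: fact_Suc)
  also have "T = (\<Sum>(j, J) \<in> UNIV \<times> ?S l.
      a (\<lambda>_. axis j 1) * b (case_nat (axis j 1) (?E J)) * c (?E J))"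
    unfolding T_def
  proof (rule sum.reindex_bij_witness[where
        i = "\<lambda>(j, J). restrict (case_nat j J) {..<Suc l}" and
        j = "\<lambda>J. (J 0, restrict (\<lambda>i. J (Suc i)) {..<l})"], goal_cases)
    case (1 J)
    then show ?case by (auto simp: PiE_def extensional_def fun_eq_iff split: nat.split)
  next
    case (5 J)
    have "a (?E J) = a (\<lambda>_. axis (J 0) 1)" by (rule alt_formsD(3)[OF a]) simp
    moreover have "b (?E J) = b (case_nat (axis (J 0) 1) (?E (restrict (\<lambda>i. J (Suc i)) {..<l})))"
      by (rule alt_formsD(3)[OF b]) (auto split: nat.split)
    moreover have "c (\<lambda>i. ?E J (Suc i)) = c (?E (restrict (\<lambda>i. J (Suc i)) {..<l}))"
      by (rule alt_formsD(3)[OF c]) simp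
    ultimately show ?case by simp
  qed (auto simp: fun_eq_iff PiE_def extensional_def)
  also have "\<dots> = (\<Sum>J \<in> ?S l. b (case_nat x (?E J)) * c (?E J))"
  proof -
    have "b (case_nat x w) = (\<Sum>j\<in>UNIV. a (\<lambda>_. axis j 1) * b (case_nat (axis j 1) w))" for w
    proof -
      have "linear (\<lambda>y. b ((case_nat x w)(0 := y)))" by (rule alt_formsD(1)[OF b]) simp
      moreover have "(case_nat x w)(0 := y) = case_nat y w" for y
        by (auto simp: fun_eq_iff split: nat.split)
      ultimately have lin: "linear (\<lambda>y. b (case_nat y w))" by simp
      show ?thesis unfolding x_def by (simp add: linear_sum[OF lin] linear_scale[OF lin])
    qed
    then show ?thesis
      by (subst sum.cartesian_product[symmetric], subst sum.swap) (simp add: sum_distrib_right)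
  qed
  finally show ?thesis by (simp add: form_inner_def)
qed

lemma int_prod_unique:
  assumes a: "a \<in> alt_forms 1" and b: "b \<in> alt_forms k" and k: "1 \<le> k"
  shows "\<exists>!d. d \<in> alt_forms (k - 1) \<and>
    (\<forall>c \<in> alt_forms (k - 1). form_inner (k - 1) d c = form_inner k b (wedge 1 (k - 1) a c))"
proof -
  obtain l where l: "k = Suc l" using k by (cases k) auto
  show ?thesis
  proof (rule ex_ex1I)
    show "\<exists>d. d \<in> alt_forms (k - 1) \<and>
      (\<forall>c \<in> alt_forms (k - 1). form_inner (k - 1) d c = form_inner k b (wedge 1 (k - 1) a c))"
      using contraction_in_alt_forms[of b l] contraction_adjoint[OF a, of b l] b
      unfolding l diff_Suc_1 by blast
  next
    fix d e
    assume d: "d \<in> alt_forms (k - 1) \<and>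
        (\<forall>c \<in> alt_forms (k - 1). form_inner (k - 1) d c = form_inner k b (wedge 1 (k - 1) a c))"
      and e: "e \<in> alt_forms (k - 1) \<and>
        (\<forall>c \<in> alt_forms (k - 1). form_inner (k - 1) e c = form_inner k b (wedge 1 (k - 1) a c))"
    let ?w = "\<lambda>v. d v - e v"
    have w: "?w \<in> alt_forms (k - 1)" using d e alt_forms_diff by blast
    have "form_inner (k - 1) ?w ?w = form_inner (k - 1) d ?w - form_inner (k - 1) e ?w"
      unfolding form_inner_def
      by (simp only: left_diff_distrib sum_subtractf diff_divide_distrib)
    also have "\<dots> = 0" using d e w by simp
    finally have "?w = (\<lambda>v. 0)" by (rule form_inner_definite[OF w])
    then show "d = e" by (simp add: fun_eq_iff)
  qed
qed

lemma int_prod_adjoint: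
  assumes "a \<in> alt_forms 1" and "b \<in> alt_forms k" and "1 \<le> k"
  shows "int_prod k a b \<in> alt_forms (k - 1)"
    and "c \<in> alt_forms (k - 1) \<Longrightarrow>
      form_inner (k - 1) (int_prod k a b) c = form_inner k b (wedge 1 (k - 1) a c)"
  using theI'[OF int_prod_unique[OF assms]] unfolding int_prod_def by blast+

end

theory Submission
  imports Defs "HOL-Library.Function_Algebras"
begin

text \<open>
  For a vector \<open>x\<close>, the pairs \<open>(x \<and> b, x \<lrcorner> b)\<close> with \<open>b\<close> a \<open>k\<close>-form make up a linear space of
  directions along which \<open>f\<close> is affine.  If \<open>u\<close>, \<open>v\<close> and \<open>u + v\<close> are directions, for instance if \<open>u\<close>
  and \<open>v\<close> are directions for the same \<open>x\<close>, then the mixed second difference of \<open>f\<close> in \<open>u\<close> and \<open>v\<close>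
  vanishes (\<open>mixed_eq_0_if_affine_along\<close>).  Everything asserted about \<open>g\<close> and \<open>h\<close> is the vanishing of
  some mixed differences on a basis of the forms, and it spreads to the span
  (\<open>mixed_eq_0_span\<close>, \<open>affine_on_span_if_mixed_eq_0\<close>).

  As basis serve the products \<open>dx\<^sub>I\<close> of coordinate forms.  A pair \<open>(dx\<^sub>I, 0)\<close> is a direction for \<open>e\<^sub>i\<close>
  if \<open>i \<in> I\<close>, since \<open>dx\<^sub>I = \<plusminus> e\<^sub>i \<and> b\<close> with \<open>e\<^sub>i \<lrcorner> b = 0\<close>, and \<open>(0, dx\<^sub>J)\<close> is one if \<open>i \<notin> J\<close>, since then
  \<open>dx\<^sub>J = e\<^sub>i \<lrcorner> (e\<^sub>i \<and> dx\<^sub>J)\<close>.  When \<open>I\<close> has \<open>k + 1\<close> elements and \<open>J\<close> has \<open>k - 1\<close>, some \<open>i\<close> lies in \<open>I\<close> but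
  not in \<open>J\<close>; hence the mixed difference of \<open>(dx\<^sub>I, 0)\<close> and \<open>(0, dx\<^sub>J)\<close> vanishes and
  \<open>f (\<xi>, \<eta>) = g \<xi> + h \<eta>\<close> (\<open>mixed_fst_snd_eq_0\<close>).

  For two forms \<open>dx\<^sub>I\<close>, \<open>dx\<^sub>J\<close> of degree \<open>k + 1\<close> the mixed difference of \<open>g\<close> vanishes as soon as \<open>I\<close>
  and \<open>J\<close> meet, which is automatic for \<open>n < 2 * (k + 1)\<close>.  If they are disjoint, replacing \<open>i\<close> in \<open>I\<close> by
  \<open>j\<close> and \<open>j\<close> in \<open>J\<close> by \<open>i\<close> changes the sign of the mixed difference (\<open>mixed_swap\<close>).  After \<open>k + 1\<close>
  exchanges \<open>I\<close> and \<open>J\<close> have changed places, so the difference equals \<open>(- 1) ^ (k + 1)\<close> times itself and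
  vanishes if \<open>k\<close> is even.  The same argument with complements of index sets handles \<open>h\<close>: two forms of
  degree \<open>k - 1\<close> lack a common index if \<open>2 * (k - 1) < n\<close>, and otherwise \<open>n - k + 1\<close> exchanges are
  made.  So \<open>g\<close> is affine if \<open>n \<le> 2 * k + 1\<close> or \<open>k\<close> is even, and \<open>h\<close> is affine if \<open>n \<ge> 2 * k - 1\<close> or
  \<open>n - k + 1\<close> is odd.  When one summand is affine, subtracting it from \<open>f\<close> shows that the other is
  one affine.
\<close>

section \<open>Mixed second differences\<close>

definition affine_along :: "('v::real_vector \<Rightarrow> real) \<Rightarrow> 'v \<Rightarrow> bool" where
  "affine_along G u \<longleftrightarrow> (\<forall>x t. G (x + t *\<^sub>R u) = G x + t * (G (x + u) - G x))"

definition mixed :: "('v::real_vector \<Rightarrow> real) \<Rightarrow> 'v \<Rightarrow> 'v \<Rightarrow> 'v \<Rightarrow> real" where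
  "mixed G u v x = G (x + u + v) - G (x + u) - G (x + v) + G x"

lemma affine_alongD: "affine_along G u \<Longrightarrow> G (x + t *\<^sub>R u) = G x + t * (G (x + u) - G x)"
  by (simp add: affine_along_def)

lemma mixed_commute: "mixed G u v x = mixed G v u x"
  by (simp add: mixed_def add.assoc add.commute[of u v])

lemma mixed_add_left: "mixed G (u + u') v x = mixed G u v (x + u') + mixed G u' v x"
  by (simp add: mixed_def algebra_simps)

lemma mixed_scaleR_left:
  assumes "affine_along G u"
  shows "mixed G (c *\<^sub>R u) v x = c * mixed G u v x"
proof -
  have "G (x + c *\<^sub>R u) = G x + c * (G (x + u) - G x)"
    and "G (x + v + c *\<^sub>R u) = G (x + v) + c * (G (x + v + u) - G (x + v))"
    by (rule affine_alongD[OF assms])+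
  then show ?thesis by (simp add: mixed_def algebra_simps)
qed

text \<open>On the plane through \<open>x\<close> spanned by \<open>u\<close> and \<open>v\<close> the function is \<open>a + b s + c t + d s t\<close>;
  being affine on the diagonal forces \<open>d = 0\<close>.\<close>

lemma mixed_eq_0_if_affine_along:
  assumes u: "affine_along G u" and v: "affine_along G v" and uv: "affine_along G (u + v)"
  shows "mixed G u v x = 0"
proof -
  have "G (x + 2 *\<^sub>R (u + v)) = G x + 2 * (G (x + (u + v)) - G x)"
    by (rule affine_alongD[OF uv])
  moreover have "G ((x + 2 *\<^sub>R u) + 2 *\<^sub>R v) =
      G (x + 2 *\<^sub>R u) + 2 * (G ((x + 2 *\<^sub>R u) + v) - G (x + 2 *\<^sub>R u))"
    by (rule affine_alongD[OF v])
  moreover have "G (x + 2 *\<^sub>R u) = G x + 2 * (G (x + u) - G x)"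
    by (rule affine_alongD[OF u])
  moreover have "G ((x + v) + 2 *\<^sub>R u) = G (x + v) + 2 * (G ((x + v) + u) - G (x + v))"
    by (rule affine_alongD[OF u])
  ultimately show ?thesis by (simp add: mixed_def algebra_simps)
qed

text \<open>If \<open>mixed G\<close> were bilinear, this would be the expansion of
  \<open>mixed G (u + u') (v + v') x = 0\<close>, whose two cross terms vanish.  Bilinearity is replaced by the
  vanishing of the mixed difference of \<open>u\<close> and \<open>u'\<close> and of the cross terms at shifted base points.\<close>

lemma mixed_swap:
  assumes "affine_along G u" "affine_along G u'" "affine_along G v" "affine_along G v'"
    and "affine_along G (u + u')" "affine_along G (v + v')"
    and "affine_along G (u + v')" "affine_along G (u' + v)"
    and "affine_along G ((u + u') + (v + v'))"
  shows "mixed G u v x = - mixed G u' v' x"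
proof -
  have "mixed G (u + u') (v + v') x = 0" "mixed G u u' x = 0" "mixed G u u' (x + v + v') = 0"
    "mixed G u v' (x + v) = 0" "mixed G u' v (x + v') = 0"
    by (rule mixed_eq_0_if_affine_along; fact assms)+
  then show ?thesis by (simp add: mixed_def algebra_simps)
qed

lemma mixed_eq_0_span_left:
  assumes aff: "\<And>u. u \<in> S \<Longrightarrow> affine_along G u"
    and zero: "\<And>u x. u \<in> S \<Longrightarrow> mixed G u v x = 0"
    and u: "u \<in> span S"
  shows "mixed G u v x = 0"
  using u
proof (induction arbitrary: x rule: span_induct_alt)
  case base
  show ?case by (simp add: mixed_def)
next
  case (step c u u')
  then show ?case by (simp add: mixed_add_left mixed_scaleR_left[OF aff] zero)
qed

lemma mixed_eq_0_span:
  assumes affS: "\<And>u. u \<in> S \<Longrightarrow> affine_along G u" and affT: "\<And>v. v \<in> T \<Longrightarrow> affine_along G v"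
    and zero: "\<And>u v x. u \<in> S \<Longrightarrow> v \<in> T \<Longrightarrow> mixed G u v x = 0"
    and u: "u \<in> span S" and v: "v \<in> span T"
  shows "mixed G u v x = 0"
proof (rule mixed_eq_0_span_left[OF affS _ u])
  fix u x assume "u \<in> S"
  then have "mixed G v u x = 0"
    using mixed_eq_0_span_left[OF affT _ v, of u x] zero mixed_commute by metis
  then show "mixed G u v x = 0" by (simp add: mixed_commute)
qed

lemma affine_on_span_if_mixed_eq_0:
  assumes aff: "\<And>u. u \<in> S \<Longrightarrow> affine_along G u"
    and zero: "\<And>u v x. u \<in> S \<Longrightarrow> v \<in> S \<Longrightarrow> mixed G u v x = 0"
    and p: "p \<in> span S" and q: "q \<in> span S"
  shows "G ((1 - t) *\<^sub>R p + t *\<^sub>R q) = (1 - t) * G p + t * G q"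
proof -
  have add: "G (u + v) = G u + G v - G 0" if "u \<in> span S" "v \<in> span S" for u v
    using mixed_eq_0_span[OF aff aff zero that, of 0] by (simp add: mixed_def)
  have base: "G (c *\<^sub>R u) = G 0 + c * (G u - G 0)" if "u \<in> S" for c u
    using affine_alongD[OF aff[OF that], of 0 c] by simp
  have "u \<in> span S \<and> G (c *\<^sub>R u) = G 0 + c * (G u - G 0)" if "u \<in> span S" for c u
    using that
  proof (induction rule: span_induct_alt)
    case base
    show ?case by (simp add: span_zero)
  next
    case (step a u u')
    then have u: "u \<in> span S" "u' \<in> span S" by (simp_all add: span_base)
    have e: "G (a *\<^sub>R u + u') = G (a *\<^sub>R u) + G u' - G 0"
      by (intro add span_scale u)
    have "G (c *\<^sub>R (a *\<^sub>R u + u')) = G ((c * a) *\<^sub>R u + c *\<^sub>R u')"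
      by (simp add: scaleR_add_right)
    also have "\<dots> = G ((c * a) *\<^sub>R u) + G (c *\<^sub>R u') - G 0"
      by (intro add span_scale u)
    also have "\<dots> = G 0 + c * (G (a *\<^sub>R u + u') - G 0)"
      using step.IH unfolding e base[OF step.hyps(1)] by (simp add: algebra_simps)
    finally show ?case using u by (simp add: span_add span_scale)
  qed
  then have scale: "G (c *\<^sub>R u) = G 0 + c * (G u - G 0)" if "u \<in> span S" for c u
    using that by blast
  have "G ((1 - t) *\<^sub>R p + t *\<^sub>R q) = G ((1 - t) *\<^sub>R p) + G (t *\<^sub>R q) - G 0"
    by (intro add span_scale p q)
  then show ?thesis by (simp only: scale[OF p] scale[OF q]) (simp add: algebra_simps)
qed

section \<open>Forms as a vector space with an inner product\<close>

instantiation "fun" :: (type, real_vector) real_vector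
begin

definition "scaleR_fun r f = (\<lambda>x. r *\<^sub>R f x)"

instance
  by standard (simp_all add: scaleR_fun_def fun_eq_iff scaleR_add_right scaleR_add_left)

end

lemma scaleR_fun_apply [simp]: "(r *\<^sub>R f) x = r *\<^sub>R f x"
  by (simp add: scaleR_fun_def)

lemma subspace_alt_forms: "subspace (alt_forms m :: ('n::finite) form set)"
proof (rule subspaceI)
  show "(0 :: 'n form) \<in> alt_forms m"
    by (simp add: alt_forms_def linear_zero)
next
  fix \<alpha> \<beta> :: "'n form" assume a: "\<alpha> \<in> alt_forms m" and b: "\<beta> \<in> alt_forms m"
  have "(\<lambda>v. \<beta> v - (\<beta> v - \<alpha> v)) \<in> alt_forms m" by (intro alt_forms_diff a b)
  have "(\<lambda>v. 0 :: real) \<in> (alt_forms m :: 'n form set)" using alt_forms_diff[OF a a] by (simp only: diff_self)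
  then have "(\<lambda>v. \<alpha> v - (0 - \<beta> v)) \<in> alt_forms m" by (intro alt_forms_diff a b)
  then show "\<alpha> + \<beta> \<in> alt_forms m" by (simp add: plus_fun_def)
next
  fix c and \<alpha> :: "'n form" assume a: "\<alpha> \<in> alt_forms m"
  show "c *\<^sub>R \<alpha> \<in> alt_forms m"
    unfolding alt_forms_def
  proof (intro CollectI conjI allI impI)
    fix v i assume "i < m"
    then show "linear (\<lambda>x. (c *\<^sub>R \<alpha>) (v(i := x)))"
      unfolding scaleR_fun_apply by (intro linear_compose_scale_right alt_formsD(1)[OF a])
  next
    fix v :: "nat \<Rightarrow> real ^ 'n" and i j assume "i < m" "j < m" "i \<noteq> j" "v i = v j"
    then show "(c *\<^sub>R \<alpha>) v = 0" by (simp add: alt_formsD(2)[OF a])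
  next
    fix v w :: "nat \<Rightarrow> real ^ 'n" assume "\<forall>i<m. v i = w i"
    then show "(c *\<^sub>R \<alpha>) v = (c *\<^sub>R \<alpha>) w" using alt_formsD(3)[OF a, of v w] by simp
  qed
qed

lemma form_inner_commute: "form_inner m \<alpha> \<beta> = form_inner m \<beta> \<alpha>"
  by (simp add: form_inner_def mult.commute)

lemma form_inner_add_left: "form_inner m (\<alpha> + \<beta>) \<gamma> = form_inner m \<alpha> \<gamma> + form_inner m \<beta> \<gamma>"
  by (simp add: form_inner_def distrib_right sum.distrib add_divide_distrib)

lemma form_inner_scaleR_left: "form_inner m (c *\<^sub>R \<alpha>) \<gamma> = c * form_inner m \<alpha> \<gamma>"
  by (simp add: form_inner_def sum_distrib_left mult.assoc)

lemma form_inner_zero_left: "form_inner m 0 \<gamma> = 0"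
  using form_inner_scaleR_left[of m 0 0 \<gamma>] by simp

lemma form_inner_sum_left:
  "finite A \<Longrightarrow> form_inner m (\<Sum>i\<in>A. \<alpha> i) \<gamma> = (\<Sum>i\<in>A. form_inner m (\<alpha> i) \<gamma>)"
  by (induction A rule: finite_induct) 
    (simp_all only: sum.empty sum.insert simp_thms form_inner_zero_left form_inner_add_left)

lemma form_eqI:
  assumes a: "\<alpha> \<in> alt_forms m" and b: "\<beta> \<in> alt_forms m"
    and eq: "\<And>\<gamma>. \<gamma> \<in> alt_forms m \<Longrightarrow> form_inner m \<alpha> \<gamma> = form_inner m \<beta> \<gamma>"
  shows "\<alpha> = \<beta>"
proof -
  have d: "\<alpha> + (-1) *\<^sub>R \<beta> \<in> alt_forms m"
    by (intro subspace_add subspace_scale subspace_alt_forms a b)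
  have "form_inner m (\<alpha> + (-1) *\<^sub>R \<beta>) (\<alpha> + (-1) *\<^sub>R \<beta>) = 0"
    by (simp only: form_inner_add_left[of m \<alpha>] form_inner_scaleR_left eq[OF d])
  then have "\<alpha> + (-1) *\<^sub>R \<beta> = (\<lambda>v. 0)" by (rule form_inner_definite[OF d])
  then show ?thesis by (simp add: fun_eq_iff)
qed

section \<open>Interior product and decomposable forms\<close>

definition flat :: "real ^ 'n \<Rightarrow> ('n::finite) form" where
  "flat x = (\<lambda>v. x \<bullet> v 0)"

definition contract :: "real ^ 'n \<Rightarrow> ('n::finite) form \<Rightarrow> 'n form" where
  "contract x b = (\<lambda>v. b (case_nat x v))"

lemma flat_in_alt_forms: "flat x \<in> alt_forms 1"
  by (simp add: alt_forms_def flat_def bounded_linear.linear[OF bounded_linear_inner_right])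

lemma contract_in_alt_forms: "b \<in> alt_forms (Suc l) \<Longrightarrow> contract x b \<in> alt_forms l"
  unfolding contract_def by (rule contraction_in_alt_forms)

lemma wedge_flat_in_alt_forms: "c \<in> alt_forms l \<Longrightarrow> wedge 1 l (flat x) c \<in> alt_forms (Suc l)"
  using wedge_in_alt_forms[OF flat_in_alt_forms, of c l] by simp

lemma form_inner_contract:
  assumes b: "b \<in> alt_forms (Suc l)" and c: "c \<in> alt_forms l"
  shows "form_inner l (contract x b) c = form_inner (Suc l) b (wedge 1 l (flat x) c)"
proof -
  have "(\<Sum>j\<in>UNIV. flat x (\<lambda>_. axis j 1) *\<^sub>R axis j 1) = x"
    using basis_expansion[of x] by (simp add: flat_def inner_axis scalar_mult_eq_scaleR)
  then show ?thesis
    using contraction_adjoint[OF flat_in_alt_forms[of x] b c] by (simp add: contract_def)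
qed

lemma int_prod_flat:
  assumes b: "b \<in> alt_forms (Suc l)"
  shows "int_prod (Suc l) (flat x) b = contract x b"
proof (rule form_eqI)
  note ip = int_prod_adjoint[OF flat_in_alt_forms[of x] b, simplified]
  show "int_prod (Suc l) (flat x) b \<in> alt_forms l" by (rule ip(1))
  show "contract x b \<in> alt_forms l" by (rule contract_in_alt_forms[OF b])
  show "form_inner l (int_prod (Suc l) (flat x) b) c = form_inner l (contract x b) c"
    if "c \<in> alt_forms l" for c
    using ip(2)[OF that] form_inner_contract[OF b that, of x] by simp
qed

lemma contract_linear:
  "contract x (b + b') = contract x b + contract x b'"
  "contract x (r *\<^sub>R b) = r *\<^sub>R contract x b"
  by (simp_all add: contract_def fun_eq_iff)

lemma wedge_linear_right:
  "wedge k l a (b + b') = wedge k l a b + wedge k l a b'"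
  "wedge k l a (r *\<^sub>R b) = r *\<^sub>R wedge k l a b"
  by (simp_all add: wedge_def fun_eq_iff distrib_left sum.distrib add_divide_distrib
      sum_distrib_left mult.assoc mult.left_commute)

text \<open>\<open>w 0 \<and> \<dots> \<and> w (m - 1)\<close>.\<close>

primrec blade :: "nat \<Rightarrow> (nat \<Rightarrow> real ^ 'n) \<Rightarrow> ('n::finite) form" where
  "blade 0 w = (\<lambda>v. 1)"
| "blade (Suc m) w = wedge 1 m (flat (w 0)) (blade m (\<lambda>i. w (Suc i)))"

lemma blade_in_alt_forms: "blade m w \<in> alt_forms m"
proof (induction m arbitrary: w)
  case 0
  show ?case by (simp add: alt_forms_def)
next
  case (Suc m)
  then show ?case by (simp del: One_nat_def add: wedge_flat_in_alt_forms)
qed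

text \<open>Decomposable forms represent evaluation.  By definiteness of the scalar product this turns
  every identity between decomposable forms into one about evaluating an arbitrary form.\<close>

lemma form_inner_blade:
  assumes "d \<in> alt_forms m"
  shows "form_inner m (blade m w) d = d w"
  using assms
proof (induction m arbitrary: w d)
  case 0
  have "d (\<lambda>i. axis undefined 1) = d w" by (rule alt_formsD(3)[OF 0]) simp
  then show ?case by (simp add: form_inner_def)
next
  case (Suc m)
  let ?w = "\<lambda>i. w (Suc i)"
  have "form_inner (Suc m) (blade (Suc m) w) d = form_inner m (contract (w 0) d) (blade m ?w)"
    using form_inner_contract[OF Suc.prems blade_in_alt_forms]
    by (simp add: form_inner_commute[of "Suc m" _ d])
  also have "\<dots> = contract (w 0) d ?w"
    by (subst form_inner_commute) (rule Suc.IH[OF contract_in_alt_forms[OF Suc.prems]])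
  also have "case_nat (w 0) ?w = w" by (auto simp: fun_eq_iff split: nat.split)
  then have "contract (w 0) d ?w = d w" by (simp add: contract_def)
  finally show ?case .
qed

lemma blade_eqI:
  assumes "\<beta> \<in> alt_forms m" and "\<And>d. d \<in> alt_forms m \<Longrightarrow> d w = form_inner m \<beta> d"
  shows "blade m w = \<beta>"
  by (rule form_eqI[OF blade_in_alt_forms assms(1)]) (simp add: form_inner_blade assms(2))

lemma blade_cong: "(\<And>i. i < m \<Longrightarrow> w i = w' i) \<Longrightarrow> blade m w = blade m w'"
  by (rule blade_eqI[OF blade_in_alt_forms]) (auto simp: form_inner_blade intro: alt_formsD(3))

lemma blade_eq_0: "i < m \<Longrightarrow> j < m \<Longrightarrow> i \<noteq> j \<Longrightarrow> w i = w j \<Longrightarrow> blade m w = 0"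
  by (rule blade_eqI)
    (simp_all only: form_inner_zero_left subspace_0[OF subspace_alt_forms] alt_formsD(2))

lemma blade_permute:
  "p permutes {..<m} \<Longrightarrow> blade m (\<lambda>i. w (p i)) = of_int (sign p) *\<^sub>R blade m w"
  by (rule blade_eqI)
    (simp_all add: form_inner_scaleR_left form_inner_blade alt_forms_permute
      subspace_scale[OF subspace_alt_forms] blade_in_alt_forms)

lemma blade_add:
  assumes "s < m"
  shows "blade m (w(s := x + y)) = blade m (w(s := x)) + blade m (w(s := y))"
proof (rule blade_eqI)
  fix d :: "'a form" assume d: "d \<in> alt_forms m"
  show "d (w(s := x + y)) = form_inner m (blade m (w(s := x)) + blade m (w(s := y))) d"
    using linear_add[OF alt_formsD(1)[OF d assms, of w]]
    by (simp add: form_inner_add_left form_inner_blade d)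
qed (intro subspace_add subspace_alt_forms blade_in_alt_forms)

lemma contract_blade_eq_0:
  assumes "\<And>i. i < Suc l \<Longrightarrow> x \<bullet> w i = 0"
  shows "contract x (blade (Suc l) w) = 0"
proof (rule form_eqI)
  fix c :: "'a form" assume c: "c \<in> alt_forms l"
  have "wedge 1 l (flat x) c w = 0"
  proof -
    have "x \<bullet> w (p 0) = 0" if "p permutes {..<1 + l}" for p
      using permutes_in_image[OF that, of 0] by (intro assms) simp
    then show ?thesis by (auto simp: wedge_def flat_def intro!: sum.neutral)
  qed
  then show "form_inner l (contract x (blade (Suc l) w)) c = form_inner l 0 c"
    using form_inner_contract[OF blade_in_alt_forms c, of x w]
      form_inner_blade[OF wedge_flat_in_alt_forms[OF c]] by (simp add: form_inner_zero_left)
qed (simp_all add: contract_in_alt_forms blade_in_alt_forms subspace_0[OF subspace_alt_forms] del: blade.simps)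

text \<open>In the sum defining the exterior product only the permutations fixing \<open>0\<close> survive, and they
  permute the remaining arguments of \<open>c\<close>.\<close>

lemma wedge_flat_orthogonal:
  assumes c: "c \<in> alt_forms l" and orth: "\<And>i. i < l \<Longrightarrow> x \<bullet> w i = 0"
  shows "wedge 1 l (flat x) c (case_nat x w) = (x \<bullet> x) * c w"
proof -
  let ?W = "case_nat x w"
  define F where "F p = of_int (sign p) * flat x (\<lambda>i. ?W (p i)) * c (\<lambda>i. ?W (p (1 + i)))" for p
  let ?Q = "{p. p permutes {1..<Suc l}}"
  have perm: "of_int (sign p) * c (\<lambda>i. V (p (Suc i))) = c (\<lambda>i. V (Suc i))"
    if p: "p permutes {1..<Suc l}" for p V
  proof -
    define q where "q = map_permutation {1..<Suc l} (\<lambda>i. i - 1) p"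
    have inj: "inj_on (\<lambda>i::nat. i - 1) {1..<Suc l}" by (auto simp: inj_on_def)
    have q: "q permutes {..<l}"
    proof -
      have im: "(\<lambda>i. i - 1) ` {1..<Suc l} = {..<l}"
      proof (intro equalityI subsetI)
        fix i assume "i \<in> {..<l}"
        then show "i \<in> (\<lambda>i. i - 1) ` {1..<Suc l}" by (intro image_eqI[of _ _ "Suc i"]) auto
      qed auto
      have "bij_betw (\<lambda>i. i - 1) {1..<Suc l} {..<l}" using inj im by (simp add: bij_betw_def)
      from map_permutation_permutes[OF this p] show ?thesis by (simp add: q_def)
    qed
    have sq: "sign q = sign p" unfolding q_def by (rule sign_map_permutation[OF inj p]) simp
    have "c (\<lambda>i. V (p (Suc i))) = c (\<lambda>i. V (Suc (q i)))"
    proof (rule alt_formsD(3)[OF c])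
      fix i assume "i < l"
      then have "p (Suc i) \<in> {1..<Suc l}" using permutes_in_image[OF p, of "Suc i"] by simp
      moreover have "q i = p (Suc i) - 1"
        using map_permutation_apply[OF inj, of "Suc i" p] \<open>i < l\<close> by (simp add: q_def)
      ultimately show "V (p (Suc i)) = V (Suc (q i))" by simp
    qed
    also have "\<dots> = of_int (sign p) * c (\<lambda>i. V (Suc i))"
      using alt_forms_permute[OF c q, of "\<lambda>i. V (Suc i)"] by (simp add: sq)
    finally have "of_int (sign p) * c (\<lambda>i. V (p (Suc i))) =
        (of_int (sign p) * of_int (sign p)) * c (\<lambda>i. V (Suc i))"
      by simp
    moreover have "of_int (sign p) * of_int (sign p) = (1::real)"
      by (simp add: sign_def)
    ultimately show ?thesis by simp
  qed
  have "(\<Sum>p | p permutes {..<1 + l}. F p) = (\<Sum>p \<in> ?Q. F p)"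
  proof (rule sum.mono_neutral_right)
    show "?Q \<subseteq> {p. p permutes {..<1 + l}}"
    proof
      fix p assume "p \<in> ?Q"
      then have "p permutes {1..<Suc l}" by simp
      then have "p permutes {..<1 + l}" by (rule permutes_subset) auto
      then show "p \<in> {p. p permutes {..<1 + l}}" by simp
    qed
    show "\<forall>p \<in> {p. p permutes {..<1 + l}} - ?Q. F p = 0"
    proof
      fix p assume p: "p \<in> {p. p permutes {..<1 + l}} - ?Q"
      have "p 0 \<noteq> 0"
      proof
        assume p0: "p 0 = 0"
        have "p permutes {..<1 + l}" using p by simp
        then have "p permutes {1..<Suc l}"
        proof (rule permutes_superset)
          fix y assume "y \<in> {..<1 + l} - {1..<Suc l}"
          then have "y = 0" by auto
          then show "p y = y" using p0 by simp
        qed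
        then show False using p by simp
      qed
      moreover have "p 0 < Suc l" using p permutes_in_image[of p "{..<1 + l}" 0] by simp
      ultimately show "F p = 0" by (cases "p 0") (simp_all add: F_def flat_def orth)
    qed
  qed (simp add: finite_permutations)
  also have "\<dots> = (\<Sum>p \<in> ?Q. (x \<bullet> x) * c w)"
  proof (rule sum.cong[OF refl])
    fix p assume "p \<in> ?Q"
    then have p: "p permutes {1..<Suc l}" by simp
    have "p 0 = 0" by (rule permutes_not_in[OF p]) simp
    then show "F p = (x \<bullet> x) * c w" using perm[OF p, of ?W] by (simp add: F_def flat_def)
  qed
  also have "\<dots> = fact l * ((x \<bullet> x) * c w)" by (simp add: card_permutations[of _ l])
  finally show ?thesis by (simp add: wedge_def F_def)
qed

lemma contract_blade_orthogonal:
  assumes orth: "\<And>i. i < l \<Longrightarrow> x \<bullet> w i = 0"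
  shows "contract x (blade (Suc l) (case_nat x w)) = (x \<bullet> x) *\<^sub>R blade l w"
proof (rule form_eqI)
  fix c :: "'a form" assume c: "c \<in> alt_forms l"
  show "form_inner l (contract x (blade (Suc l) (case_nat x w))) c =
      form_inner l ((x \<bullet> x) *\<^sub>R blade l w) c"
    by (simp only: form_inner_contract[OF blade_in_alt_forms c] form_inner_scaleR_left
        form_inner_blade[OF c] form_inner_blade[OF wedge_flat_in_alt_forms[OF c]]
        wedge_flat_orthogonal[OF c orth])
qed (simp_all add: contract_in_alt_forms blade_in_alt_forms subspace_scale[OF subspace_alt_forms]
    del: blade.simps)

definition basis_blade :: "nat \<Rightarrow> (nat \<Rightarrow> 'n) \<Rightarrow> ('n::finite) form" where
  "basis_blade m I = blade m (\<lambda>i. axis (I i) 1)"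

text \<open>The sum \<open>\<sigma>\<close> below runs over all index tuples and thus contains each basis form, with its sign,
  \<open>m!\<close> times.\<close>

lemma alt_forms_eq_span:
  "alt_forms m = span {basis_blade m I | I :: nat \<Rightarrow> 'n::finite. inj_on I {..<m}}" (is "_ = span ?B")
proof (rule subset_antisym)
  show "span ?B \<subseteq> alt_forms m"
    by (rule span_minimal[OF _ subspace_alt_forms]) (auto simp: basis_blade_def blade_in_alt_forms)
  show "alt_forms m \<subseteq> span ?B"
  proof
    fix \<omega> :: "'n form" assume w: "\<omega> \<in> alt_forms m"
    let ?S = "{..<m} \<rightarrow>\<^sub>E (UNIV :: 'n set)"
    have fin: "finite ?S" by (rule finite_PiE) simp_all
    define \<sigma> where "\<sigma> = (\<Sum>J\<in>?S. (\<omega> (\<lambda>i. axis (J i) 1) / fact m) *\<^sub>R basis_blade m J)"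
    have "basis_blade m J \<in> span ?B" for J :: "nat \<Rightarrow> 'n"
    proof (cases "inj_on J {..<m}")
      case True
      then show ?thesis by (intro span_base) blast
    next
      case False
      then have "basis_blade m J = 0"
        unfolding basis_blade_def inj_on_def by (auto intro: blade_eq_0)
      then show ?thesis by (simp add: span_zero)
    qed
    then have s: "\<sigma> \<in> span ?B" unfolding \<sigma>_def by (intro span_sum span_scale)
    have "\<omega> = \<sigma>"
    proof (rule form_eqI[OF w])
      show "\<sigma> \<in> alt_forms m" using s \<open>span ?B \<subseteq> alt_forms m\<close> by blast
      show "form_inner m \<omega> d = form_inner m \<sigma> d" if "d \<in> alt_forms m" for d
        unfolding \<sigma>_def
        by (simp add: form_inner_sum_left[OF fin] form_inner_scaleR_left basis_blade_def
            form_inner_blade[OF that]) (simp add: form_inner_def sum_divide_distrib)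
    qed
    then show "\<omega> \<in> span ?B" using s by simp
  qed
qed

section \<open>Directions\<close>

definition directions :: "nat \<Rightarrow> real ^ 'n \<Rightarrow> (('n::finite) form \<times> 'n form) set" where
  "directions l x = {(wedge 1 (Suc l) (flat x) b, contract x b) | b. b \<in> alt_forms (Suc l)}"

lemma directionsI:
  "b \<in> alt_forms (Suc l) \<Longrightarrow> (wedge 1 (Suc l) (flat x) b, contract x b) \<in> directions l x"
  unfolding directions_def by blast

lemma directions_subset: "directions l x \<subseteq> alt_forms (Suc (Suc l)) \<times> alt_forms l"
  unfolding directions_def
  by (auto simp del: One_nat_def simp: wedge_flat_in_alt_forms contract_in_alt_forms)

lemma subspace_directions: "subspace (directions l x)"
proof (rule subspaceI)
  have "wedge 1 (Suc l) (flat x) 0 = 0" "contract x 0 = 0"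
    by (simp_all add: wedge_def contract_def fun_eq_iff)
  then show "0 \<in> directions l x"
    using directionsI[OF subspace_0[OF subspace_alt_forms], of l x] by (simp only: zero_prod_def)
next
  fix p q assume "p \<in> directions l x" "q \<in> directions l x"
  then obtain b c where "b \<in> alt_forms (Suc l)" "c \<in> alt_forms (Suc l)"
    "p = (wedge 1 (Suc l) (flat x) b, contract x b)"
    "q = (wedge 1 (Suc l) (flat x) c, contract x c)"
    unfolding directions_def by blast
  then show "p + q \<in> directions l x"
    using directionsI[OF subspace_add[OF subspace_alt_forms, of b l c for l], of l x]
    by (simp only: wedge_linear_right contract_linear add_Pair)
next
  fix r p assume "p \<in> directions l x"
  then obtain b where "b \<in> alt_forms (Suc l)" "p = (wedge 1 (Suc l) (flat x) b, contract x b)"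
    unfolding directions_def by blast
  then show "r *\<^sub>R p \<in> directions l x"
    using directionsI[OF subspace_scale[OF subspace_alt_forms, of b], of l x r]
    by (simp only: wedge_linear_right contract_linear scaleR_Pair)
qed

text \<open>Up to sign the form is \<open>x \<and> b\<close> with \<open>b\<close> the product of the factors other than \<open>x = w s\<close>, and
  \<open>b\<close> is annihilated by the interior product with \<open>x\<close>.\<close>

lemma blade_fst_direction:
  assumes s: "s < Suc (Suc l)"
    and orth: "\<And>i. i < Suc (Suc l) \<Longrightarrow> i \<noteq> s \<Longrightarrow> w s \<bullet> w i = 0"
  shows "(blade (Suc (Suc l)) w, 0) \<in> directions l (w s)"
proof -
  define p where "p = Transposition.transpose 0 s"
  define w' where "w' i = w (p i)" for i
  have p: "p permutes {..<Suc (Suc l)}"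
    unfolding p_def using s by (intro permutes_swap_id) auto
  have w0: "w' 0 = w s" by (simp add: w'_def p_def)
  have "w s \<bullet> w' (Suc i) = 0" if "i < Suc l" for i
  proof -
    have "p (Suc i) < Suc (Suc l)" using permutes_in_image[OF p, of "Suc i"] that by simp
    moreover have "p (Suc i) \<noteq> s" by (simp add: p_def Transposition.transpose_def)
    ultimately show ?thesis by (simp add: w'_def orth)
  qed
  then have "contract (w s) (blade (Suc l) (\<lambda>i. w' (Suc i))) = 0"
    by (rule contract_blade_eq_0)
  then have "(blade (Suc (Suc l)) w', 0) \<in> directions l (w s)"
    using directionsI[OF blade_in_alt_forms[of "Suc l" "\<lambda>i. w' (Suc i)"], of "w s"]
    by (simp only: blade.simps(2)[of "Suc l" w'] w0)
  then have "of_int (sign p) *\<^sub>R (blade (Suc (Suc l)) w', 0) \<in> directions l (w s)"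
    by (rule subspace_scale[OF subspace_directions])
  moreover have "blade (Suc (Suc l)) w' = of_int (sign p) *\<^sub>R blade (Suc (Suc l)) w"
    unfolding w'_def by (rule blade_permute[OF p])
  moreover have "of_int (sign p) * of_int (sign p) = (1::real)"
    by (simp add: sign_def)
  ultimately show ?thesis
    by (simp only: scaleR_Pair scaleR_scaleR scaleR_one scaleR_zero_right)
qed

text \<open>Here \<open>b = x \<and> w 0 \<and> \<dots> \<and> w (l - 1)\<close>, divided by \<open>x \<bullet> x\<close>; its exterior product with \<open>x\<close>
  contains \<open>x\<close> twice.\<close>

lemma blade_snd_direction:
  assumes x: "x \<noteq> 0" and orth: "\<And>i. i < l \<Longrightarrow> x \<bullet> w i = 0"
  shows "(0, blade l w) \<in> directions l x"
proof -
  let ?b = "blade (Suc l) (case_nat x w)"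
  have "wedge 1 (Suc l) (flat x) ?b = blade (Suc (Suc l)) (case_nat x (case_nat x w))"
    by (simp only: blade.simps(2)[of "Suc l"]) simp
  also have "\<dots> = 0" by (rule blade_eq_0[of 0 _ 1]) simp_all
  finally have "(0, (x \<bullet> x) *\<^sub>R blade l w) \<in> directions l x"
    using directionsI[OF blade_in_alt_forms[of "Suc l" "case_nat x w"], of x]
    by (simp only: contract_blade_orthogonal[OF orth])
  then have "inverse (x \<bullet> x) *\<^sub>R (0, (x \<bullet> x) *\<^sub>R blade l w) \<in> directions l x"
    by (rule subspace_scale[OF subspace_directions])
  moreover have "inverse (x \<bullet> x) * (x \<bullet> x) = 1" using x by simp
  ultimately show ?thesis
    by (simp only: scaleR_Pair scaleR_scaleR scaleR_one scaleR_zero_right)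
qed

lemma inner_axis_distinct: "i \<noteq> j \<Longrightarrow> axis i (1::real) \<bullet> axis j 1 = 0"
  by (simp add: inner_axis_axis)

lemma basis_blade_fst_direction:
  assumes "inj_on I {..<Suc (Suc l)}" and "s < Suc (Suc l)"
  shows "(basis_blade (Suc (Suc l)) I, 0) \<in> directions l (axis (I s) 1)"
  unfolding basis_blade_def
  by (rule blade_fst_direction[OF assms(2)], rule inner_axis_distinct)
    (use assms in \<open>auto simp: inj_on_def\<close>)

lemma basis_blade_snd_direction:
  assumes "i \<notin> I ` {..<l}"
  shows "(0, basis_blade l I) \<in> directions l (axis i 1)"
  unfolding basis_blade_def
  by (rule blade_snd_direction, simp, rule inner_axis_distinct) (use assms in auto)

text \<open>Two basis forms differing in one slot add up to a decomposable form, so the sum is again a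
  direction, now for a combination of two coordinate vectors.\<close>

lemma basis_blade_add_update:
  assumes "s < m"
  shows "basis_blade m I + basis_blade m (I(s := j)) =
    blade m ((\<lambda>i. axis (I i) 1)(s := axis (I s) 1 + axis j 1))"
proof -
  have "(\<lambda>i. axis ((I(s := j)) i) 1) = (\<lambda>i. axis (I i) (1::real))(s := axis j 1)"
    by (auto simp: fun_eq_iff)
  moreover have "(\<lambda>i. axis (I i) 1)(s := axis (I s) 1) = (\<lambda>i. axis (I i) (1::real))"
    by (auto simp: fun_eq_iff)
  ultimately show ?thesis by (simp only: basis_blade_def blade_add[OF assms])
qed

lemma basis_blade_update_fst_direction:
  assumes inj: "inj_on I {..<Suc (Suc l)}" and s: "s < Suc (Suc l)"
    and j: "j \<notin> I ` {..<Suc (Suc l)}"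
  shows "(basis_blade (Suc (Suc l)) I + basis_blade (Suc (Suc l)) (I(s := j)), 0)
    \<in> directions l (axis (I s) 1 + axis j 1)"
proof -
  let ?w = "(\<lambda>i. axis (I i) (1::real))(s := axis (I s) 1 + axis j 1)"
  have "?w s \<bullet> ?w i = 0" if "i < Suc (Suc l)" "i \<noteq> s" for i
    using that inj s j by (auto simp: inner_add_left inner_axis_axis inj_on_def)
  from blade_fst_direction[where w = ?w, OF s this] show ?thesis
    unfolding basis_blade_add_update[OF s] by simp
qed

lemma basis_blade_update_snd_direction:
  assumes inj: "inj_on I {..<l}" and s: "s < l" and j: "j \<notin> I ` {..<l}"
    and x: "x = axis (I s) 1 - axis j 1 \<or> x = axis j 1 - axis (I s) 1"
  shows "(0, basis_blade l I + basis_blade l (I(s := j))) \<in> directions l x"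
  unfolding basis_blade_add_update[OF s]
proof (rule blade_snd_direction)
  have ne: "I s \<noteq> j" using s j by blast
  have "x \<bullet> axis j 1 \<noteq> 0" using x ne by (auto simp: inner_diff_left inner_axis_axis)
  then show "x \<noteq> 0" by auto
  fix i assume i: "i < l"
  show "x \<bullet> ((\<lambda>i. axis (I i) 1)(s := axis (I s) 1 + axis j 1)) i = 0"
  proof (cases "i = s")
    case True
    then show ?thesis using x ne
      by (auto simp: inner_diff_left inner_add_right inner_axis_axis)
  next
    case False
    then have "I i \<noteq> I s" "I i \<noteq> j" using inj i s j by (auto simp: inj_on_def)
    then show ?thesis using x False by (auto simp: inner_diff_left inner_axis_axis)
  qed
qed

section \<open>Exchanging indices\<close>

text \<open>Indices occurring in both tuples sit in the same slot, so that exchanging the entries of a slot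
  keeps both tuples injective.\<close>

definition matched :: "nat \<Rightarrow> (nat \<Rightarrow> 'a) \<Rightarrow> (nat \<Rightarrow> 'a) \<Rightarrow> bool" where
  "matched m I J \<longleftrightarrow> inj_on I {..<m} \<and> inj_on J {..<m} \<and>
     (\<forall>s<m. \<forall>t<m. I s = J t \<longrightarrow> s = t)"

lemma matchedD:
  assumes "matched m I J" and "s < m" and "I s \<noteq> J s"
  shows "J s \<notin> I ` {..<m}" and "I s \<notin> J ` {..<m}"
  using assms unfolding matched_def by force+

lemma matched_exchange:
  assumes "matched m I J" and "s < m"
  shows "matched m (I(s := J s)) (J(s := I s))"
proof -
  have "inj_on (I(s := J s)) {..<m} \<and> inj_on (J(s := I s)) {..<m}"
  proof (cases "I s = J s")
    case True
    then show ?thesis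
      using assms(1) unfolding matched_def by (metis fun_upd_triv)
  next
    case False
    then show ?thesis
      using assms(1) matchedD[OF assms False] unfolding matched_def
      by (blast intro: inj_on_fun_updI)
  qed
  moreover have "a = b" if ab: "a < m" "b < m" "(I(s := J s)) a = (J(s := I s)) b" for a b
  proof -
    have "I a = I s \<Longrightarrow> a = s" "J s = J b \<Longrightarrow> s = b" "I a = J b \<Longrightarrow> a = b"
      using assms ab(1,2) unfolding matched_def inj_on_def by auto
    then show ?thesis using ab(3) by (simp split: if_splits)
  qed
  ultimately show ?thesis unfolding matched_def by blast
qed

lemma exists_matched_permutation:
  assumes I: "inj_on I {..<m}" and J: "inj_on J {..<m}"
  obtains p where "p permutes {..<m}" and "matched m I (\<lambda>i. J (p i))"
proof -
  let ?A = "{..<m}"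
  define K where "K = {s \<in> ?A. I s \<in> J ` ?A}"
  define f where "f s = inv_into ?A J (I s)" for s
  have f: "f s \<in> ?A" "J (f s) = I s" if "s \<in> K" for s
  proof -
    have "I s \<in> J ` ?A" using that by (simp only: K_def mem_Collect_eq)
    then show "f s \<in> ?A" "J (f s) = I s"
      unfolding f_def by (rule inv_into_into, rule f_inv_into_f)
  qed
  have injf: "inj_on f K"
  proof (rule inj_onI)
    fix s t assume st: "s \<in> K" "t \<in> K" "f s = f t"
    then have "I s = I t" using f(2)[of s] f(2)[of t] by simp
    then show "s = t" using I st unfolding K_def inj_on_def by blast
  qed
  have KA: "K \<subseteq> ?A" and fA: "f ` K \<subseteq> ?A" using f by (auto simp: K_def)
  have "card (?A - K) = card (?A - f ` K)"
    using KA fA injf by (simp add: card_Diff_subset finite_subset[OF KA] card_image)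
  then obtain g where g: "bij_betw g (?A - K) (?A - f ` K)"
    using finite_same_card_bij[of "?A - K" "?A - f ` K"] by auto
  define p where "p s = (if s \<in> K then f s else if s \<in> ?A then g s else s)" for s
  have "bij_betw p K (f ` K)"
    using injf by (simp add: bij_betw_def p_def cong: inj_on_cong image_cong)
  moreover have "bij_betw p (?A - K) (?A - f ` K)"
    using g by (rule bij_betw_cong[THEN iffD1, rotated]) (simp add: p_def)
  ultimately have "bij_betw p (K \<union> (?A - K)) (f ` K \<union> (?A - f ` K))"
    by (rule bij_betw_combine) auto
  then have "bij_betw p ?A ?A" using KA fA by (simp add: Un_absorb1)
  then have p: "p permutes ?A"
    by (rule bij_imp_permutes) (use KA in \<open>auto simp: p_def\<close>)
  have "inj_on (\<lambda>i. J (p i)) ?A"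
    using comp_inj_on[OF permutes_inj_on[OF p], of J ?A] J
    by (simp add: permutes_image[OF p] comp_def)
  moreover have "s = t" if st: "s < m" "t < m" "I s = J (p t)" for s t
  proof -
    have pt: "p t \<in> ?A" using permutes_in_image[OF p, of t] st by simp
    then have s: "s \<in> K" using st by (auto simp: K_def)
    then have "J (p s) = J (p t)" using st f(2)[OF s] by (simp add: p_def)
    then have "p s = p t" using J pt f(1)[OF s] s by (auto simp: inj_on_def p_def)
    then show "s = t" using permutes_inj[OF p] by (simp add: inj_eq)
  qed
  ultimately have "matched m I (\<lambda>i. J (p i))" using I by (simp add: matched_def)
  with p show ?thesis by (rule that)
qed

text \<open>Exchanging one after the other all slots in which \<open>I\<close> and \<open>J\<close> differ turns \<open>(I, J)\<close> into
  \<open>(J, I)\<close>; each exchange changes the sign, and the mixed difference is symmetric.\<close>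

lemma mixed_matched_eq_0:
  fixes I J :: "nat \<Rightarrow> 'n::finite"
  assumes exchange: "\<And>I J s. matched m I J \<Longrightarrow> s < m \<Longrightarrow> I s \<noteq> J s \<Longrightarrow>
      mixed G (basis_blade m I) (basis_blade m J) x =
      - mixed G (basis_blade m (I(s := J s))) (basis_blade m (J(s := I s))) x"
    and IJ: "matched m I J" and odd: "odd (card {s. s < m \<and> I s \<noteq> J s})"
  shows "mixed G (basis_blade m I) (basis_blade m J) x = 0"
proof -
  let ?D = "{s. s < m \<and> I s \<noteq> J s}"
  define I' where "I' T = (\<lambda>s. if s \<in> T then J s else I s)" for T
  define J' where "J' T = (\<lambda>s. if s \<in> T then I s else J s)" for T
  have "matched m (I' T) (J' T) \<and>
      mixed G (basis_blade m (I' T)) (basis_blade m (J' T)) x =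
      (-1) ^ card T * mixed G (basis_blade m I) (basis_blade m J) x"
    if "finite T" "T \<subseteq> ?D" for T
    using that
  proof (induction T rule: finite_induct)
    case empty
    then show ?case using IJ by (simp add: I'_def J'_def)
  next
    case (insert s T)
    then have s: "s < m" "I' T s \<noteq> J' T s" and m: "matched m (I' T) (J' T)"
      by (auto simp: I'_def J'_def)
    have eq: "I' (insert s T) = (I' T)(s := J' T s)" "J' (insert s T) = (J' T)(s := I' T s)"
      using insert.hyps by (auto simp: I'_def J'_def fun_eq_iff)
    have "matched m (I' (insert s T)) (J' (insert s T))"
      unfolding eq by (rule matched_exchange[OF m s(1)])
    moreover have "mixed G (basis_blade m (I' (insert s T))) (basis_blade m (J' (insert s T))) x =
        - mixed G (basis_blade m (I' T)) (basis_blade m (J' T)) x"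
      unfolding eq using exchange[OF m s] by linarith
    ultimately show ?case using insert by simp
  qed
  from this[of ?D] have "mixed G (basis_blade m (I' ?D)) (basis_blade m (J' ?D)) x =
      - mixed G (basis_blade m I) (basis_blade m J) x"
    using odd by simp
  moreover have "basis_blade m (I' ?D) = basis_blade m J" "basis_blade m (J' ?D) = basis_blade m I"
    unfolding basis_blade_def by (auto intro!: blade_cong simp: I'_def J'_def)
  ultimately show ?thesis using mixed_commute[of G "basis_blade m J"] by simp
qed

text \<open>Permuting the slots of \<open>J\<close> changes its basis form only by a sign and makes \<open>I\<close> and \<open>J\<close> matched;
  the slots in which they then differ correspond to the indices of \<open>I\<close> not in \<open>J\<close>.\<close>

lemma mixed_basis_blades_eq_0:
  fixes I J :: "nat \<Rightarrow> 'n::finite"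
  assumes aff: "\<And>I. inj_on I {..<m} \<Longrightarrow> affine_along G (basis_blade m I)"
    and exchange: "\<And>I J s. matched m I J \<Longrightarrow> s < m \<Longrightarrow> I s \<noteq> J s \<Longrightarrow>
      mixed G (basis_blade m I) (basis_blade m J) x =
      - mixed G (basis_blade m (I(s := J s))) (basis_blade m (J(s := I s))) x"
    and I: "inj_on I {..<m}" and J: "inj_on J {..<m}"
    and odd: "odd (card (I ` {..<m} - J ` {..<m}))"
  shows "mixed G (basis_blade m I) (basis_blade m J) x = 0"
proof -
  obtain p where p: "p permutes {..<m}" and m: "matched m I (\<lambda>i. J (p i))" (is "matched m I ?J")
    using exists_matched_permutation[OF I J] .
  have im: "?J ` {..<m} = J ` {..<m}"
    using permutes_image[OF p] by (metis image_image)
  have "I ` {..<m} - J ` {..<m} = I ` {s. s < m \<and> I s \<noteq> ?J s}"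
  proof -
    have "I s \<in> ?J ` {..<m} \<longleftrightarrow> I s = ?J s" if "s < m" for s
      using m that unfolding matched_def by auto
    then show ?thesis unfolding im[symmetric] by auto
  qed
  moreover have "inj_on I {s. s < m \<and> I s \<noteq> ?J s}" by (rule inj_on_subset[OF I]) auto
  ultimately have "odd (card {s. s < m \<and> I s \<noteq> ?J s})" using odd by (simp add: card_image)
  then have "mixed G (basis_blade m ?J) (basis_blade m I) x = 0"
    using mixed_matched_eq_0[OF exchange m] by (simp add: mixed_commute)
  moreover have "basis_blade m J = of_int (sign p) *\<^sub>R basis_blade m ?J"
  proof -
    have "basis_blade m ?J = of_int (sign p) *\<^sub>R basis_blade m J"
      unfolding basis_blade_def by (rule blade_permute[OF p])
    moreover have "of_int (sign p) * of_int (sign p) = (1::real)" by (simp add: sign_def)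
    ultimately show ?thesis by (simp only: scaleR_scaleR scaleR_one)
  qed
  moreover have "affine_along G (basis_blade m ?J)"
    using m by (intro aff) (simp add: matched_def)
  ultimately have "mixed G (basis_blade m J) (basis_blade m I) x = 0"
    by (simp add: mixed_scaleR_left)
  then show ?thesis by (simp add: mixed_commute)
qed

section \<open>Functions affine along all directions\<close>

lemma exists_missing_index:
  fixes I :: "nat \<Rightarrow> 'n::finite"
  assumes "l < CARD('n)"
  obtains i where "i \<notin> I ` {..<l}"
proof -
  have "card (I ` {..<l}) < CARD('n)" using card_image_le[of "{..<l}" I] assms by simp
  then have "I ` {..<l} \<noteq> UNIV" by auto
  then show ?thesis using that by blast
qed

text \<open>The form \<open>\<xi>\<close> has a factor \<open>dx\<^sub>i\<close> that \<open>\<eta>\<close> lacks, so \<open>(\<xi>, 0)\<close> and \<open>(0, \<eta>)\<close> are both directions for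
  the vector \<open>e\<^sub>i\<close>.\<close>

lemma mixed_fst_snd_eq_0:
  fixes F :: "('n::finite) form \<times> 'n form \<Rightarrow> real"
  assumes aff: "\<And>x d. d \<in> directions l x \<Longrightarrow> affine_along F d"
    and I: "inj_on I {..<Suc (Suc l)}" and J: "inj_on J {..<l}"
  shows "mixed F (basis_blade (Suc (Suc l)) I, 0) (0, basis_blade l J) z = 0"
proof -
  have "card (J ` {..<l}) < card (I ` {..<Suc (Suc l)})" using I J by (simp add: card_image)
  moreover have "card (I ` {..<Suc (Suc l)}) \<le> card (J ` {..<l})"
    if "I ` {..<Suc (Suc l)} \<subseteq> J ` {..<l}"
    by (rule card_mono[OF _ that]) simp
  ultimately have "\<not> I ` {..<Suc (Suc l)} \<subseteq> J ` {..<l}" by linarith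
  then obtain s where s: "s < Suc (Suc l)" "I s \<notin> J ` {..<l}" by blast
  note u = basis_blade_fst_direction[OF I s(1)] and v = basis_blade_snd_direction[OF s(2)]
  show ?thesis
    by (rule mixed_eq_0_if_affine_along[OF aff[OF u] aff[OF v]
          aff[OF subspace_add[OF subspace_directions u v]]])
qed

text \<open>Two basis forms with a common factor \<open>dx\<^sub>i\<close> are directions for \<open>e\<^sub>i\<close>.  If they have none, then
  \<open>2 * (l + 2) \<le> n\<close> and there are \<open>l + 2\<close> indices to exchange; an exchange of \<open>i\<close> and \<open>j\<close> uses the vector \<open>e\<^sub>i + e\<^sub>j\<close>.\<close>

lemma mixed_fst_eq_0:
  fixes F :: "('n::finite) form \<times> 'n form \<Rightarrow> real"
  defines "G \<equiv> \<lambda>\<xi>. F (\<xi>, 0)"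
  assumes aff: "\<And>x d. d \<in> directions l x \<Longrightarrow> affine_along F d"
    and deg: "CARD('n) < 2 * Suc (Suc l) \<or> odd l"
    and I: "inj_on I {..<Suc (Suc l)}" and J: "inj_on J {..<Suc (Suc l)}"
  shows "mixed G (basis_blade (Suc (Suc l)) I) (basis_blade (Suc (Suc l)) J) z = 0"
proof -
  let ?m = "Suc (Suc l)"
  let ?b = "basis_blade ?m"
  have affG: "affine_along G \<xi>" if "(\<xi>, 0) \<in> directions l x" for \<xi> x
  proof -
    have "F ((y, 0) + t *\<^sub>R (\<xi>, 0)) = F (y, 0) + t * (F ((y, 0) + (\<xi>, 0)) - F (y, 0))" for y t
      by (rule affine_alongD[OF aff[OF that]])
    then show ?thesis by (simp add: affine_along_def G_def del: plus_fun_apply)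
  qed
  have add: "(\<xi> + \<xi>', 0) \<in> directions l x"
    if "(\<xi>, 0) \<in> directions l x" "(\<xi>', 0) \<in> directions l x" for \<xi> \<xi>' x
    using subspace_add[OF subspace_directions that] by (simp only: add_Pair add_0_right)
  have single: "affine_along G (?b I)" if "inj_on I {..<?m}" for I :: "nat \<Rightarrow> 'n"
    by (rule affG, rule basis_blade_fst_direction[OF that, of 0]) simp
  have common: "affine_along G (?b I + ?b J)"
    if "inj_on I {..<?m}" "inj_on J {..<?m}" "s < ?m" "t < ?m" "I s = J t"
    for I J :: "nat \<Rightarrow> 'n" and s t
    by (rule affG[OF add[OF basis_blade_fst_direction[OF that(1,3)]
            basis_blade_fst_direction[OF that(2,4), folded that(5)]]])
  have exchange: "mixed G (?b I) (?b J) z = - mixed G (?b (I(s := J s))) (?b (J(s := I s))) z"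
    if m: "matched ?m I J" and s: "s < ?m" and ne: "I s \<noteq> J s" for I J :: "nat \<Rightarrow> 'n" and s
  proof -
    have inj: "inj_on I {..<?m}" "inj_on J {..<?m}"
      "inj_on (I(s := J s)) {..<?m}" "inj_on (J(s := I s)) {..<?m}"
      using m matched_exchange[OF m s] unfolding matched_def by blast+
    have u: "(?b I + ?b (I(s := J s)), 0) \<in> directions l (axis (I s) 1 + axis (J s) 1)"
      by (rule basis_blade_update_fst_direction[OF inj(1) s matchedD(1)[OF m s ne]])
    have v: "(?b J + ?b (J(s := I s)), 0) \<in> directions l (axis (I s) 1 + axis (J s) 1)"
      using basis_blade_update_fst_direction[OF inj(2) s matchedD(2)[OF m s ne]]
      by (simp only: add.commute[of "axis (I s) 1"])
    have 1: "affine_along G (?b I + ?b (J(s := I s)))"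
      by (rule common[OF inj(1,4) s s]) simp
    have 2: "affine_along G (?b (I(s := J s)) + ?b J)"
      by (rule common[OF inj(3,2) s s]) simp
    show ?thesis
      by (rule mixed_swap[OF single[OF inj(1)] single[OF inj(3)] single[OF inj(2)]
            single[OF inj(4)] affG[OF u] affG[OF v] 1 2 affG[OF add[OF u v]]])
  qed
  show ?thesis
  proof (cases "I ` {..<?m} \<inter> J ` {..<?m} = {}")
    case True
    have "card (I ` {..<?m} \<union> J ` {..<?m}) = ?m + ?m"
      using True I J by (simp add: card_Un_disjoint card_image)
    moreover have "card (I ` {..<?m} \<union> J ` {..<?m}) \<le> CARD('n)"
      by (rule card_mono) simp_all
    ultimately have "odd l" using deg by simp
    moreover have "I ` {..<?m} - J ` {..<?m} = I ` {..<?m}" using True by blast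
    ultimately have "odd (card (I ` {..<?m} - J ` {..<?m}))" using I by (simp add: card_image)
    then show ?thesis using mixed_basis_blades_eq_0[OF single exchange I J] by blast
  next
    case False
    then obtain s t where "s < ?m" "t < ?m" "I s = J t" by blast
    then show ?thesis
      by (rule mixed_eq_0_if_affine_along[OF single[OF I] single[OF J] common[OF I J]])
  qed
qed

text \<open>The dual situation: two basis forms lacking the same \<open>dx\<^sub>i\<close> are directions for \<open>e\<^sub>i\<close>; if
  between them they use all indices, \<open>n - l\<close> indices remain to be exchanged, and an exchange of \<open>i\<close>
  and \<open>j\<close> uses \<open>e\<^sub>i - e\<^sub>j\<close>.\<close>

lemma mixed_snd_eq_0:
  fixes F :: "('n::finite) form \<times> 'n form \<Rightarrow> real"
  defines "G \<equiv> \<lambda>\<eta>. F (0, \<eta>)"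
  assumes aff: "\<And>x d. d \<in> directions l x \<Longrightarrow> affine_along F d"
    and l: "l < CARD('n)" and deg: "2 * l < CARD('n) \<or> odd (CARD('n) - l)"
    and I: "inj_on I {..<l}" and J: "inj_on J {..<l}"
  shows "mixed G (basis_blade l I) (basis_blade l J) z = 0"
proof -
  let ?b = "basis_blade l"
  have affG: "affine_along G \<eta>" if "(0, \<eta>) \<in> directions l x" for \<eta> x
  proof -
    have "F ((0, y) + t *\<^sub>R (0, \<eta>)) = F (0, y) + t * (F ((0, y) + (0, \<eta>)) - F (0, y))" for y t
      by (rule affine_alongD[OF aff[OF that]])
    then show ?thesis by (simp add: affine_along_def G_def del: plus_fun_apply)
  qed
  have add: "(0, \<eta> + \<eta>') \<in> directions l x"
    if "(0, \<eta>) \<in> directions l x" "(0, \<eta>') \<in> directions l x" for \<eta> \<eta>' x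
    using subspace_add[OF subspace_directions that] by (simp only: add_Pair add_0_right)
  have single: "affine_along G (?b I)" for I :: "nat \<Rightarrow> 'n"
  proof -
    obtain i where "i \<notin> I ` {..<l}" using exists_missing_index[OF l] .
    then show ?thesis by (rule affG[OF basis_blade_snd_direction])
  qed
  have common: "affine_along G (?b I + ?b J)"
    if "i \<notin> I ` {..<l}" "i \<notin> J ` {..<l}" for I J :: "nat \<Rightarrow> 'n" and i
    by (rule affG[OF add[OF basis_blade_snd_direction[OF that(1)]
            basis_blade_snd_direction[OF that(2)]]])
  have exchange: "mixed G (?b I) (?b J) z = - mixed G (?b (I(s := J s))) (?b (J(s := I s))) z"
    if m: "matched l I J" and s: "s < l" and ne: "I s \<noteq> J s" for I J :: "nat \<Rightarrow> 'n" and s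
  proof -
    have inj: "inj_on I {..<l}" "inj_on J {..<l}" using m unfolding matched_def by blast+
    have u: "(0, ?b I + ?b (I(s := J s))) \<in> directions l (axis (I s) 1 - axis (J s) 1)"
      by (rule basis_blade_update_snd_direction[OF inj(1) s matchedD(1)[OF m s ne]]) simp
    have v: "(0, ?b J + ?b (J(s := I s))) \<in> directions l (axis (I s) 1 - axis (J s) 1)"
      by (rule basis_blade_update_snd_direction[OF inj(2) s matchedD(2)[OF m s ne]]) simp
    have "J s \<notin> J ` ({..<l} - {s})" "I s \<notin> I ` ({..<l} - {s})"
      using inj s by (auto simp: inj_on_def)
    then have "J s \<notin> J(s := I s) ` {..<l}" "I s \<notin> I(s := J s) ` {..<l}"
      unfolding fun_upd_image using ne s by (metis insert_iff lessThan_iff)+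
    then have 1: "affine_along G (?b I + ?b (J(s := I s)))"
      and 2: "affine_along G (?b (I(s := J s)) + ?b J)"
      using matchedD[OF m s ne] by (blast intro: common)+
    show ?thesis
      by (rule mixed_swap[OF single single single single affG[OF u] affG[OF v] 1 2
            affG[OF add[OF u v]]])
  qed
  show ?thesis
  proof (cases "I ` {..<l} \<union> J ` {..<l} = UNIV")
    case True
    then have "CARD('n) \<le> card (I ` {..<l}) + card (J ` {..<l})"
      using card_Un_le[of "I ` {..<l}" "J ` {..<l}"] by simp
    then have "odd (CARD('n) - l)" using deg I J by (simp add: card_image)
    moreover have "I ` {..<l} - J ` {..<l} = UNIV - J ` {..<l}" using True by blast
    ultimately have "odd (card (I ` {..<l} - J ` {..<l}))"
      using J by (simp add: card_Diff_subset card_image)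
    then show ?thesis using mixed_basis_blades_eq_0[OF single exchange I J] by blast
  next
    case False
    then obtain i where "i \<notin> I ` {..<l}" "i \<notin> J ` {..<l}" by blast
    then show ?thesis by (rule mixed_eq_0_if_affine_along[OF single single common])
  qed
qed

section \<open>One affine functions\<close>

text \<open>The convexity inequalities in both directions give the equation for \<open>t\<close> in the unit interval; for
  other \<open>t\<close> one of \<open>0\<close>, \<open>1\<close> is a convex combination of \<open>t\<close> and the other.\<close>

lemma convex_concave_iff_affine:
  fixes \<phi> :: "real \<Rightarrow> real"
  shows "convex_on UNIV \<phi> \<and> convex_on UNIV (\<lambda>t. - \<phi> t) \<longleftrightarrow>
    (\<forall>t. \<phi> t = \<phi> 0 + t * (\<phi> 1 - \<phi> 0))"
proof
  assume cc: "convex_on UNIV \<phi> \<and> convex_on UNIV (\<lambda>t. - \<phi> t)"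
  have comb: "\<phi> ((1 - s) * x + s * y) = (1 - s) * \<phi> x + s * \<phi> y" if "0 \<le> s" "s \<le> 1" for s x y
    using convex_onD[OF conjunct1[OF cc] that, of x y] convex_onD[OF conjunct2[OF cc] that, of x y]
    by simp
  show "\<forall>t. \<phi> t = \<phi> 0 + t * (\<phi> 1 - \<phi> 0)"
  proof
    fix t :: real
    consider "0 \<le> t \<and> t \<le> 1" | "t > 1" | "t < 0" by linarith
    then show "\<phi> t = \<phi> 0 + t * (\<phi> 1 - \<phi> 0)"
    proof cases
      case 1
      then show ?thesis using comb[of t 0 1] by (simp add: algebra_simps)
    next
      case 2
      then have "\<phi> 1 = (1 - 1 / t) * \<phi> 0 + (1 / t) * \<phi> t" using comb[of "1 / t" 0 t] by simp
      then have "t * \<phi> 1 = t * ((1 - 1 / t) * \<phi> 0 + (1 / t) * \<phi> t)" by simp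
      also have "\<dots> = (t - 1) * \<phi> 0 + \<phi> t" using 2 by (simp add: field_simps)
      finally show ?thesis by (simp add: algebra_simps)
    next
      case 3
      define s where "s = - t / (1 - t)"
      have s: "0 \<le> s" "s \<le> 1" "(1 - s) * t + s * 1 = 0" "(1 - t) * (1 - s) = 1" "(1 - t) * s = - t"
        using 3 by (simp_all add: s_def field_simps)
      have "(1 - t) * \<phi> 0 = (1 - t) * ((1 - s) * \<phi> t + s * \<phi> 1)"
        using comb[OF s(1,2), of t 1] s(3) by simp
      also have "\<dots> = ((1 - t) * (1 - s)) * \<phi> t + ((1 - t) * s) * \<phi> 1" by (simp add: algebra_simps)
      finally show ?thesis unfolding s by (simp add: algebra_simps)
    qed
  qed
next
  assume aff: "\<forall>t. \<phi> t = \<phi> 0 + t * (\<phi> 1 - \<phi> 0)"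
  define a c where "a = \<phi> 0" and "c = \<phi> 1 - \<phi> 0"
  have "\<phi> t = a + t * c" for t using aff unfolding a_def c_def by blast
  then have "\<phi> ((1 - s) *\<^sub>R x + s *\<^sub>R y) = (1 - s) * \<phi> x + s * \<phi> y" for s x y
    by (simp add: algebra_simps)
  then show "convex_on UNIV \<phi> \<and> convex_on UNIV (\<lambda>t. - \<phi> t)"
    by (auto intro!: convex_onI)
qed

lemma form_line_eq: "(\<lambda>v. \<omega> v + t * \<theta> v) = \<omega> + t *\<^sub>R \<theta>"
  by (simp add: fun_eq_iff)

lemma ext_int_one_affine_iff:
  "ext_int_one_affine k f \<longleftrightarrow>
    (\<forall>\<xi> \<in> alt_forms (k + 1). \<forall>\<eta> \<in> alt_forms (k - 1). \<forall>a \<in> alt_forms 1. \<forall>b \<in> alt_forms k. \<forall>t.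
      f ((\<xi>, \<eta>) + t *\<^sub>R (wedge 1 k a b, int_prod k a b)) =
      f (\<xi>, \<eta>) + t * (f ((\<xi>, \<eta>) + (wedge 1 k a b, int_prod k a b)) - f (\<xi>, \<eta>)))"
  (is "_ \<longleftrightarrow> ?R")
proof -
  have "ext_int_one_affine k f \<longleftrightarrow>
    (\<forall>\<xi> \<in> alt_forms (k + 1). \<forall>\<eta> \<in> alt_forms (k - 1). \<forall>a \<in> alt_forms 1. \<forall>b \<in> alt_forms k.
      convex_on UNIV (\<lambda>t. f (\<xi> + t *\<^sub>R wedge 1 k a b, \<eta> + t *\<^sub>R int_prod k a b)) \<and>
      convex_on UNIV (\<lambda>t. - f (\<xi> + t *\<^sub>R wedge 1 k a b, \<eta> + t *\<^sub>R int_prod k a b)))"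
    unfolding ext_int_one_affine_def ext_int_one_convex_def form_line_eq by blast
  then show ?thesis
    unfolding convex_concave_iff_affine scaleR_zero_left add_0_right scaleR_one add_Pair scaleR_Pair .
qed

lemma ext_one_affine_iff:
  "ext_one_affine m g \<longleftrightarrow>
    (\<forall>\<omega> \<in> alt_forms m. \<forall>a \<in> alt_forms 1. \<forall>b \<in> alt_forms (m - 1). \<forall>t.
      g (\<omega> + t *\<^sub>R wedge 1 (m - 1) a b) =
      g \<omega> + t * (g (\<omega> + wedge 1 (m - 1) a b) - g \<omega>))"
proof -
  have "ext_one_affine m g \<longleftrightarrow>
    (\<forall>\<omega> \<in> alt_forms m. \<forall>a \<in> alt_forms 1. \<forall>b \<in> alt_forms (m - 1).
      convex_on UNIV (\<lambda>t. g (\<omega> + t *\<^sub>R wedge 1 (m - 1) a b)) \<and>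
      convex_on UNIV (\<lambda>t. - g (\<omega> + t *\<^sub>R wedge 1 (m - 1) a b)))"
    unfolding ext_one_affine_def ext_one_convex_def form_line_eq by blast
  then show ?thesis
    unfolding convex_concave_iff_affine scaleR_zero_left add_0_right scaleR_one .
qed

lemma int_one_affine_iff:
  "int_one_affine m h \<longleftrightarrow>
    (\<forall>\<omega> \<in> alt_forms m. \<forall>a \<in> alt_forms 1. \<forall>b \<in> alt_forms (m + 1). \<forall>t.
      h (\<omega> + t *\<^sub>R int_prod (m + 1) a b) =
      h \<omega> + t * (h (\<omega> + int_prod (m + 1) a b) - h \<omega>))"
proof -
  have "int_one_affine m h \<longleftrightarrow>
    (\<forall>\<omega> \<in> alt_forms m. \<forall>a \<in> alt_forms 1. \<forall>b \<in> alt_forms (m + 1).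
      convex_on UNIV (\<lambda>t. h (\<omega> + t *\<^sub>R int_prod (m + 1) a b)) \<and>
      convex_on UNIV (\<lambda>t. - h (\<omega> + t *\<^sub>R int_prod (m + 1) a b)))"
    unfolding int_one_affine_def int_one_convex_def form_line_eq by blast
  then show ?thesis
    unfolding convex_concave_iff_affine scaleR_zero_left add_0_right scaleR_one .
qed

lemma affine_on_forms_iff:
  "affine_on_forms m g \<longleftrightarrow>
    (\<forall>p \<in> alt_forms m. \<forall>q \<in> alt_forms m. \<forall>t.
      g ((1 - t) *\<^sub>R p + t *\<^sub>R q) = (1 - t) * g p + t * g q)"
proof -
  have "(\<lambda>v. (1 - t) * p v + t * q v) = (1 - t) *\<^sub>R p + t *\<^sub>R q" for t and p q :: "'a form"
    by (simp add: fun_eq_iff)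
  then show ?thesis by (simp only: affine_on_forms_def)
qed

lemma affine_on_forms_line:
  assumes "affine_on_forms m g" and \<omega>: "\<omega> \<in> alt_forms m" and \<theta>: "\<theta> \<in> alt_forms m"
  shows "g (\<omega> + t *\<^sub>R \<theta>) = g \<omega> + t * (g (\<omega> + \<theta>) - g \<omega>)"
proof -
  have "\<omega> + t *\<^sub>R \<theta> = (1 - t) *\<^sub>R \<omega> + t *\<^sub>R (\<omega> + \<theta>)" by (simp add: fun_eq_iff algebra_simps)
  then show ?thesis
    using assms(1)[unfolded affine_on_forms_iff, rule_format, OF \<omega> subspace_add[OF subspace_alt_forms \<omega> \<theta>], of t]
    by (simp only:) (simp add: algebra_simps)
qed

lemma affine_imp_ext_one_affine: "affine_on_forms (Suc m) g \<Longrightarrow> ext_one_affine (Suc m) g"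
  unfolding ext_one_affine_iff
  using wedge_in_alt_forms[of _ 1 _ m]
  by (auto intro!: affine_on_forms_line simp del: One_nat_def simp: plus_1_eq_Suc)

lemma affine_imp_int_one_affine: "affine_on_forms m h \<Longrightarrow> int_one_affine m h"
  unfolding int_one_affine_iff
  using int_prod_adjoint(1)[of _ _ "m + 1"] by (auto intro!: affine_on_forms_line simp del: One_nat_def)

text \<open>Cutting \<open>f\<close> off outside the forms of the given degrees makes it affine along each direction
  through every point, because a line in such a direction that meets these forms stays in them.\<close>

lemma ext_int_one_affine_cut_off:
  fixes f :: "('n::finite) form \<times> 'n form \<Rightarrow> real"
  assumes f: "ext_int_one_affine (Suc l) f" and d: "d \<in> directions l x"
  shows "affine_along (\<lambda>z. if z \<in> alt_forms (Suc (Suc l)) \<times> alt_forms l then f z else 0) d"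
    (is "affine_along ?F d")
proof -
  let ?W = "alt_forms (Suc (Suc l)) \<times> (alt_forms l :: 'n form set)"
  have W: "subspace ?W" by (intro subspace_Times subspace_alt_forms)
  have dW: "d \<in> ?W" using d directions_subset by blast
  have mem: "z + t *\<^sub>R d \<in> ?W \<longleftrightarrow> z \<in> ?W" for z t
  proof
    assume "z + t *\<^sub>R d \<in> ?W"
    then have "(z + t *\<^sub>R d) - t *\<^sub>R d \<in> ?W" by (intro subspace_diff W subspace_scale dW)
    then show "z \<in> ?W" by (simp only: add_diff_cancel_right')
  qed (intro subspace_add W subspace_scale dW)
  have mem1: "z + d \<in> ?W \<longleftrightarrow> z \<in> ?W" for z using mem[of z 1] by (simp only: scaleR_one)
  obtain b where b: "b \<in> alt_forms (Suc l)" "d = (wedge 1 (Suc l) (flat x) b, contract x b)"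
    using d unfolding directions_def by blast
  have "f (z + t *\<^sub>R d) = f z + t * (f (z + d) - f z)" if "z \<in> ?W" for z t
  proof (cases z)
    case (Pair \<xi> \<eta>)
    then have "\<xi> \<in> alt_forms (Suc l + 1)" "\<eta> \<in> alt_forms (Suc l - 1)" using that by simp_all
    from f[unfolded ext_int_one_affine_iff, rule_format, OF this flat_in_alt_forms[of x] b(1), of t]
    show ?thesis unfolding int_prod_flat[OF b(1)] Pair b(2) .
  qed
  then have "?F (z + t *\<^sub>R d) = ?F z + t * (?F (z + d) - ?F z)" for z t
    unfolding mem mem1 by (cases "z \<in> ?W") (simp_all only: if_True if_False diff_self mult_zero_right add_0_right)
  then show ?thesis unfolding affine_along_def by blast
qed

section \<open>The decomposition\<close>

text \<open>The summands are the restrictions of \<open>f\<close> to the two factors, normalised to add up correctly at \<open>0\<close>;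
  the vanishing mixed differences of basis forms are spread to all forms by linearity.\<close>

lemma ext_int_one_affine_decomposition:
  fixes f :: "('n::finite) form \<times> 'n form \<Rightarrow> real"
  assumes f: "ext_int_one_affine (Suc l) f" and l: "l < CARD('n)"
  obtains g h :: "'n form \<Rightarrow> real"
  where "\<And>\<xi> \<eta>. \<xi> \<in> alt_forms (Suc (Suc l)) \<Longrightarrow> \<eta> \<in> alt_forms l \<Longrightarrow> f (\<xi>, \<eta>) = g \<xi> + h \<eta>"
    and "CARD('n) < 2 * Suc (Suc l) \<or> odd l \<Longrightarrow> affine_on_forms (Suc (Suc l)) g"
    and "2 * l < CARD('n) \<or> odd (CARD('n) - l) \<Longrightarrow> affine_on_forms l h"
proof -
  let ?A = "alt_forms (Suc (Suc l)) :: 'n form set" and ?B = "alt_forms l :: 'n form set"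
  define F where "F = (\<lambda>z. if z \<in> ?A \<times> ?B then f z else 0)"
  have aff: "affine_along F d" if "d \<in> directions l x" for d x
    unfolding F_def by (rule ext_int_one_affine_cut_off[OF f that])
  define S where "S = {basis_blade (Suc (Suc l)) I | I :: nat \<Rightarrow> 'n. inj_on I {..<Suc (Suc l)}}"
  define T where "T = {basis_blade l I | I :: nat \<Rightarrow> 'n. inj_on I {..<l}}"
  have A: "?A = span S" and B: "?B = span T" by (simp_all only: S_def T_def alt_forms_eq_span)
  have zero: "0 \<in> ?A" "0 \<in> ?B" by (rule subspace_0[OF subspace_alt_forms])+
  define g where "g \<xi> = F (\<xi>, 0)" for \<xi>
  define h' where "h' \<eta> = F (0, \<eta>)" for \<eta>
  define h where "h \<eta> = h' \<eta> - F (0, 0)" for \<eta>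
  have affS: "affine_along F (u, 0)" if u: "u \<in> S" for u
  proof -
    obtain I :: "nat \<Rightarrow> 'n" where I: "inj_on I {..<Suc (Suc l)}" "u = basis_blade (Suc (Suc l)) I"
      using u S_def by blast
    show ?thesis unfolding I(2) by (rule aff, rule basis_blade_fst_direction[OF I(1), of 0]) simp
  qed
  have affT: "affine_along F (0, v)" if v: "v \<in> T" for v
  proof -
    obtain I :: "nat \<Rightarrow> 'n" where I: "v = basis_blade l I" using v T_def by blast
    obtain i where "i \<notin> I ` {..<l}" using exists_missing_index[OF l] .
    then show ?thesis unfolding I by (rule aff[OF basis_blade_snd_direction])
  qed
  have split: "f (\<xi>, \<eta>) = g \<xi> + h \<eta>" if \<xi>: "\<xi> \<in> ?A" and \<eta>: "\<eta> \<in> ?B" for \<xi> \<eta>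
  proof -
    have lin: "linear (\<lambda>u :: 'n form. (u, 0 :: 'n form))"
      "linear (\<lambda>v :: 'n form. (0 :: 'n form, v))"
      by (simp_all add: linear_iff)
    have inS: "(\<xi>, 0 :: 'n form) \<in> span ((\<lambda>u. (u, 0)) ` S)"
      using \<xi> unfolding A linear_span_image[OF lin(1)] by blast
    have inT: "(0 :: 'n form, \<eta>) \<in> span ((\<lambda>v. (0, v)) ` T)"
      using \<eta> unfolding B linear_span_image[OF lin(2)] by blast
    have "mixed F (\<xi>, 0) (0, \<eta>) 0 = 0"
    proof (rule mixed_eq_0_span[OF _ _ _ inS inT])
      fix u v z :: "'n form \<times> 'n form" assume "u \<in> (\<lambda>u. (u, 0)) ` S" "v \<in> (\<lambda>v. (0, v)) ` T"
      then obtain I J :: "nat \<Rightarrow> 'n" where "inj_on I {..<Suc (Suc l)}" "inj_on J {..<l}"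
        "u = (basis_blade (Suc (Suc l)) I, 0)" "v = (0, basis_blade l J)"
        unfolding S_def T_def by blast
      then show "mixed F u v z = 0"
        using mixed_fst_snd_eq_0[where F = F and l = l, OF aff] by simp
    qed (use affS affT in blast)+
    then have "F (\<xi>, \<eta>) = F (\<xi>, 0) + F (0, \<eta>) - F (0, 0)"
      by (simp only: mixed_def zero_prod_def add_Pair add_0_left add_0_right)
    moreover have "F (\<xi>, \<eta>) = f (\<xi>, \<eta>)" using \<xi> \<eta> by (simp add: F_def)
    ultimately show ?thesis by (simp only: g_def h_def h'_def)
  qed
  have affg: "affine_along g u" if u: "u \<in> S" for u
  proof -
    have "F (y + t *\<^sub>R u, 0) = F (y, 0) + t * (F (y + u, 0) - F (y, 0))" for y t
      using affine_alongD[OF affS[OF u], of "(y, 0)" t]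
      by (simp only: scaleR_Pair add_Pair scaleR_zero_right add_0_right)
    then show ?thesis unfolding affine_along_def g_def by blast
  qed
  have affh: "affine_along h' v" if v: "v \<in> T" for v
  proof -
    have "F (0, y + t *\<^sub>R v) = F (0, y) + t * (F (0, y + v) - F (0, y))" for y t
      using affine_alongD[OF affT[OF v], of "(0, y)" t]
      by (simp only: scaleR_Pair add_Pair scaleR_zero_right add_0_right)
    then show ?thesis unfolding affine_along_def h'_def by blast
  qed
  have "affine_on_forms (Suc (Suc l)) g" if deg: "CARD('n) < 2 * Suc (Suc l) \<or> odd l"
  proof -
    have "mixed g u v x = 0" if uv: "u \<in> S" "v \<in> S" for u v x
    proof -
      obtain I J :: "nat \<Rightarrow> 'n" where "inj_on I {..<Suc (Suc l)}" "inj_on J {..<Suc (Suc l)}"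
        "u = basis_blade (Suc (Suc l)) I" "v = basis_blade (Suc (Suc l)) J"
        using uv unfolding S_def by blast
      then show ?thesis
        using mixed_fst_eq_0[where F = F and l = l, OF aff deg] unfolding g_def by simp
    qed
    then show ?thesis
      unfolding affine_on_forms_iff A using affine_on_span_if_mixed_eq_0[OF affg] by blast
  qed
  moreover have "affine_on_forms l h" if deg: "2 * l < CARD('n) \<or> odd (CARD('n) - l)"
  proof -
    have "mixed h' u v x = 0" if uv: "u \<in> T" "v \<in> T" for u v x
    proof -
      obtain I J :: "nat \<Rightarrow> 'n" where "inj_on I {..<l}" "inj_on J {..<l}"
        "u = basis_blade l I" "v = basis_blade l J"
        using uv unfolding T_def by blast
      then show ?thesis
        using mixed_snd_eq_0[where F = F and l = l, OF aff l deg] unfolding h'_def by simp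
    qed
    then have "h' ((1 - t) *\<^sub>R p + t *\<^sub>R q) = (1 - t) * h' p + t * h' q"
      if "p \<in> ?B" "q \<in> ?B" for p q t
      using affine_on_span_if_mixed_eq_0[OF affh] that unfolding B by blast
    then show ?thesis unfolding affine_on_forms_iff h_def by (simp add: algebra_simps)
  qed
  ultimately show ?thesis using that[OF split] by blast
qed

text \<open>Along \<open>(a \<and> b, a \<lrcorner> b)\<close> both \<open>f\<close> and the affine summand are affine, hence so is their difference.\<close>

lemma ext_one_affine_if_sum:
  assumes f: "ext_int_one_affine (Suc l) f"
    and split: "\<And>\<xi> \<eta>. \<xi> \<in> alt_forms (Suc (Suc l)) \<Longrightarrow> \<eta> \<in> alt_forms l \<Longrightarrow> f (\<xi>, \<eta>) = g \<xi> + h \<eta>"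
    and h: "affine_on_forms l h"
  shows "ext_one_affine (Suc (Suc l)) g"
  unfolding ext_one_affine_iff
proof (intro ballI allI)
  fix \<omega> a b :: "'a form" and t :: real
  assume \<omega>: "\<omega> \<in> alt_forms (Suc (Suc l))" and a: "a \<in> alt_forms 1"
    and "b \<in> alt_forms (Suc (Suc l) - 1)"
  then have b: "b \<in> alt_forms (Suc l)" by simp
  let ?w = "wedge 1 (Suc l) a b" and ?i = "int_prod (Suc l) a b"
  have w: "?w \<in> alt_forms (Suc (Suc l))" using wedge_in_alt_forms[OF a b] by (simp only: plus_1_eq_Suc)
  have i: "?i \<in> alt_forms l" using int_prod_adjoint(1)[OF a b] by simp
  have zero: "(0 :: 'a form) \<in> alt_forms l" by (rule subspace_0[OF subspace_alt_forms])
  have "f (\<omega> + t *\<^sub>R ?w, 0 + t *\<^sub>R ?i) = f (\<omega>, 0) + t * (f (\<omega> + ?w, 0 + ?i) - f (\<omega>, 0))"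
    using f[unfolded ext_int_one_affine_iff, rule_format, of \<omega> 0 a b t] \<omega> zero a b
    by (simp only: scaleR_Pair add_Pair Suc_eq_plus1 add_diff_cancel_right')
  moreover have "h (0 + t *\<^sub>R ?i) = h 0 + t * (h (0 + ?i) - h 0)"
    by (rule affine_on_forms_line[OF h zero i])
  moreover have "\<omega> + t *\<^sub>R ?w \<in> alt_forms (Suc (Suc l))" "0 + t *\<^sub>R ?i \<in> alt_forms l"
    "\<omega> + ?w \<in> alt_forms (Suc (Suc l))" "0 + ?i \<in> alt_forms l"
    by (intro subspace_add subspace_scale subspace_alt_forms \<omega> w i zero)+
  ultimately have "g (\<omega> + t *\<^sub>R ?w) + (h 0 + t * (h (0 + ?i) - h 0)) =
      g \<omega> + h 0 + t * (g (\<omega> + ?w) + h (0 + ?i) - (g \<omega> + h 0))"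
    by (simp only: split \<omega> zero)
  then have "g (\<omega> + t *\<^sub>R ?w) = g \<omega> + t * (g (\<omega> + ?w) - g \<omega>)" by (simp only: algebra_simps)
  then show "g (\<omega> + t *\<^sub>R wedge 1 (Suc (Suc l) - 1) a b) =
      g \<omega> + t * (g (\<omega> + wedge 1 (Suc (Suc l) - 1) a b) - g \<omega>)" by (simp only: diff_Suc_1)
qed

lemma int_one_affine_if_sum:
  assumes f: "ext_int_one_affine (Suc l) f"
    and split: "\<And>\<xi> \<eta>. \<xi> \<in> alt_forms (Suc (Suc l)) \<Longrightarrow> \<eta> \<in> alt_forms l \<Longrightarrow> f (\<xi>, \<eta>) = g \<xi> + h \<eta>"
    and g: "affine_on_forms (Suc (Suc l)) g"
  shows "int_one_affine l h"
  unfolding int_one_affine_iff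
proof (intro ballI allI)
  fix \<omega> a b :: "'a form" and t :: real
  assume \<omega>: "\<omega> \<in> alt_forms l" and a: "a \<in> alt_forms 1" and "b \<in> alt_forms (l + 1)"
  then have b: "b \<in> alt_forms (Suc l)" by simp
  let ?w = "wedge 1 (Suc l) a b" and ?i = "int_prod (Suc l) a b"
  have w: "?w \<in> alt_forms (Suc (Suc l))" using wedge_in_alt_forms[OF a b] by (simp only: plus_1_eq_Suc)
  have i: "?i \<in> alt_forms l" using int_prod_adjoint(1)[OF a b] by simp
  have zero: "(0 :: 'a form) \<in> alt_forms (Suc (Suc l))" by (rule subspace_0[OF subspace_alt_forms])
  have "f (0 + t *\<^sub>R ?w, \<omega> + t *\<^sub>R ?i) = f (0, \<omega>) + t * (f (0 + ?w, \<omega> + ?i) - f (0, \<omega>))"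
    using f[unfolded ext_int_one_affine_iff, rule_format, of 0 \<omega> a b t] \<omega> zero a b
    by (simp only: scaleR_Pair add_Pair Suc_eq_plus1 add_diff_cancel_right')
  moreover have "g (0 + t *\<^sub>R ?w) = g 0 + t * (g (0 + ?w) - g 0)"
    by (rule affine_on_forms_line[OF g zero w])
  moreover have "0 + t *\<^sub>R ?w \<in> alt_forms (Suc (Suc l))" "\<omega> + t *\<^sub>R ?i \<in> alt_forms l"
    "0 + ?w \<in> alt_forms (Suc (Suc l))" "\<omega> + ?i \<in> alt_forms l"
    by (intro subspace_add subspace_scale subspace_alt_forms \<omega> w i zero)+
  ultimately have "(g 0 + t * (g (0 + ?w) - g 0)) + h (\<omega> + t *\<^sub>R ?i) =
      g 0 + h \<omega> + t * (g (0 + ?w) + h (\<omega> + ?i) - (g 0 + h \<omega>))"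
    by (simp only: split \<omega> zero)
  then have "h (\<omega> + t *\<^sub>R ?i) = h \<omega> + t * (h (\<omega> + ?i) - h \<omega>)" by (simp only: algebra_simps)
  then show "h (\<omega> + t *\<^sub>R int_prod (l + 1) a b) =
      h \<omega> + t * (h (\<omega> + int_prod (l + 1) a b) - h \<omega>)" by (simp only: Suc_eq_plus1)
qed

lemma ext_int_one_affine_if_sum:
  assumes split: "\<And>\<xi> \<eta>. \<xi> \<in> alt_forms (Suc (Suc l)) \<Longrightarrow> \<eta> \<in> alt_forms l \<Longrightarrow> f (\<xi>, \<eta>) = g \<xi> + h \<eta>"
    and g: "ext_one_affine (Suc (Suc l)) g" and h: "int_one_affine l h"
  shows "ext_int_one_affine (Suc l) f"
  unfolding ext_int_one_affine_iff
proof (intro ballI allI)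
  fix \<xi> \<eta> a b :: "'a form" and t :: real
  assume "\<xi> \<in> alt_forms (Suc l + 1)" "\<eta> \<in> alt_forms (Suc l - 1)"
    and a: "a \<in> alt_forms 1" and b: "b \<in> alt_forms (Suc l)"
  then have \<xi>: "\<xi> \<in> alt_forms (Suc (Suc l))" and \<eta>: "\<eta> \<in> alt_forms l" by simp_all
  let ?w = "wedge 1 (Suc l) a b" and ?i = "int_prod (Suc l) a b"
  have w: "?w \<in> alt_forms (Suc (Suc l))" using wedge_in_alt_forms[OF a b] by (simp only: plus_1_eq_Suc)
  have i: "?i \<in> alt_forms l" using int_prod_adjoint(1)[OF a b] by simp
  have "g (\<xi> + t *\<^sub>R ?w) = g \<xi> + t * (g (\<xi> + ?w) - g \<xi>)"
    using g[unfolded ext_one_affine_iff, rule_format, OF \<xi> a, of b t] b by (simp only: diff_Suc_1)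
  moreover have "h (\<eta> + t *\<^sub>R ?i) = h \<eta> + t * (h (\<eta> + ?i) - h \<eta>)"
    using h[unfolded int_one_affine_iff, rule_format, OF \<eta> a, of b t] b by (simp only: Suc_eq_plus1)
  moreover have "\<xi> + t *\<^sub>R ?w \<in> alt_forms (Suc (Suc l))" "\<eta> + t *\<^sub>R ?i \<in> alt_forms l"
    "\<xi> + ?w \<in> alt_forms (Suc (Suc l))" "\<eta> + ?i \<in> alt_forms l"
    by (intro subspace_add subspace_scale subspace_alt_forms \<xi> \<eta> w i)+
  ultimately show "f ((\<xi>, \<eta>) + t *\<^sub>R (?w, ?i)) =
      f (\<xi>, \<eta>) + t * (f ((\<xi>, \<eta>) + (?w, ?i)) - f (\<xi>, \<eta>))"
    by (simp only: scaleR_Pair add_Pair split \<xi> \<eta>) (simp add: algebra_simps)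
qed

theorem corollary21:
  fixes k :: nat and f :: "('n::finite) form \<times> 'n form \<Rightarrow> real"
  assumes "1 \<le> k" and "k \<le> CARD('n) - 1"
  shows "ext_int_one_affine k f \<longleftrightarrow>
    (\<exists>(g :: 'n form \<Rightarrow> real) (h :: 'n form \<Rightarrow> real).
      (\<forall>\<xi> \<in> alt_forms (k + 1). \<forall>\<eta> \<in> alt_forms (k - 1). f (\<xi>, \<eta>) = g \<xi> + h \<eta>) \<and>
      (CARD('n) \<le> 2 * k - 2 \<longrightarrow>
        affine_on_forms (k + 1) g \<and> int_one_affine (k - 1) h) \<and>
      (CARD('n) \<in> {2 * k - 1, 2 * k, 2 * k + 1} \<or> (even k \<and> even CARD('n)) \<longrightarrow>
        affine_on_forms (k + 1) g \<and> affine_on_forms (k - 1) h) \<and>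
      (CARD('n) \<ge> 2 * k + 2 \<longrightarrow>
        ext_one_affine (k + 1) g \<and> affine_on_forms (k - 1) h))"
proof -
  obtain l where k: "k = Suc l" using assms(1) by (cases k) auto
  have l: "l < CARD('n)" using assms(2) k by simp
  have deg: "k + 1 = Suc (Suc l)" "k - 1 = l" by (simp_all add: k)
  show ?thesis
    unfolding deg
  proof (intro iffI)
    assume f: "ext_int_one_affine k f"
    obtain g h :: "'n form \<Rightarrow> real" where
      split: "\<And>\<xi> \<eta>. \<xi> \<in> alt_forms (Suc (Suc l)) \<Longrightarrow> \<eta> \<in> alt_forms l \<Longrightarrow> f (\<xi>, \<eta>) = g \<xi> + h \<eta>"
      and g: "CARD('n) < 2 * Suc (Suc l) \<or> odd l \<Longrightarrow> affine_on_forms (Suc (Suc l)) g"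
      and h: "2 * l < CARD('n) \<or> odd (CARD('n) - l) \<Longrightarrow> affine_on_forms l h"
      using ext_int_one_affine_decomposition[OF f[unfolded k] l] by blast
    have "affine_on_forms (Suc (Suc l)) g \<and> int_one_affine l h" if "CARD('n) \<le> 2 * k - 2"
      using that g int_one_affine_if_sum[OF f[unfolded k] split] by (simp add: k)
    moreover have "affine_on_forms (Suc (Suc l)) g \<and> affine_on_forms l h"
      if "CARD('n) \<in> {2 * k - 1, 2 * k, 2 * k + 1} \<or> (even k \<and> even CARD('n))"
    proof -
      have "CARD('n) < 2 * Suc (Suc l) \<or> odd l" "2 * l < CARD('n) \<or> odd (CARD('n) - l)"
        using that l by (auto simp: k)
      then show ?thesis using g h by blast
    qed
    moreover have "ext_one_affine (Suc (Suc l)) g \<and> affine_on_forms l h" if "2 * k + 2 \<le> CARD('n)"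
      using that h ext_one_affine_if_sum[OF f[unfolded k] split] by (simp add: k)
    ultimately show "\<exists>g h. (\<forall>\<xi>\<in>alt_forms (Suc (Suc l)). \<forall>\<eta>\<in>alt_forms l. f (\<xi>, \<eta>) = g \<xi> + h \<eta>) \<and>
      (CARD('n) \<le> 2 * k - 2 \<longrightarrow> affine_on_forms (Suc (Suc l)) g \<and> int_one_affine l h) \<and>
      (CARD('n) \<in> {2 * k - 1, 2 * k, 2 * k + 1} \<or> (even k \<and> even CARD('n)) \<longrightarrow>
        affine_on_forms (Suc (Suc l)) g \<and> affine_on_forms l h) \<and>
      (CARD('n) \<ge> 2 * k + 2 \<longrightarrow> ext_one_affine (Suc (Suc l)) g \<and> affine_on_forms l h)"
      using split by blast
  next
    assume "\<exists>g h. (\<forall>\<xi>\<in>alt_forms (Suc (Suc l)). \<forall>\<eta>\<in>alt_forms l. f (\<xi>, \<eta>) = g \<xi> + h \<eta>) \<and>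
      (CARD('n) \<le> 2 * k - 2 \<longrightarrow> affine_on_forms (Suc (Suc l)) g \<and> int_one_affine l h) \<and>
      (CARD('n) \<in> {2 * k - 1, 2 * k, 2 * k + 1} \<or> (even k \<and> even CARD('n)) \<longrightarrow>
        affine_on_forms (Suc (Suc l)) g \<and> affine_on_forms l h) \<and>
      (CARD('n) \<ge> 2 * k + 2 \<longrightarrow> ext_one_affine (Suc (Suc l)) g \<and> affine_on_forms l h)"
    then obtain g h where split: "\<forall>\<xi>\<in>alt_forms (Suc (Suc l)). \<forall>\<eta>\<in>alt_forms l. f (\<xi>, \<eta>) = g \<xi> + h \<eta>"
      and cases: "CARD('n) \<le> 2 * k - 2 \<longrightarrow> affine_on_forms (Suc (Suc l)) g \<and> int_one_affine l h"
        "CARD('n) \<in> {2 * k - 1, 2 * k, 2 * k + 1} \<longrightarrow>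
          affine_on_forms (Suc (Suc l)) g \<and> affine_on_forms l h"
        "CARD('n) \<ge> 2 * k + 2 \<longrightarrow> ext_one_affine (Suc (Suc l)) g \<and> affine_on_forms l h"
      by blast
    have "CARD('n) \<le> 2 * k - 2 \<or> CARD('n) \<in> {2 * k - 1, 2 * k, 2 * k + 1} \<or> CARD('n) \<ge> 2 * k + 2"
      by auto
    then have "ext_one_affine (Suc (Suc l)) g \<and> int_one_affine l h"
      using cases affine_imp_ext_one_affine affine_imp_int_one_affine by blast
    then show "ext_int_one_affine k f"
      unfolding k using split by (intro ext_int_one_affine_if_sum[of l f g h]) blast+
  qed
qed

end
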